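(* Let $\{h_i\}$ be a complex random process with $h_i\neq0$ with probability $1$ and such that $\frac1k\sum_{i=1}^k\log_2|h_i|^2$ converges in probability, as $k\to\infty$, to the constant $\mathbb{E}_h[\log_2|h|^2]$. Let $L_k\subset\mathbb{C}^k$ (with $k\to\infty$) be an infinite family of $2k$-dimensional lattices whose normalized product distances satisfy $(\mathrm{Nd}_{p,\min}(L_k))^{2/k}\ge c$ for some constant $c>0$. Then, for power constraint $P>0$, any rate $$R<\mathbb{E}_h\left[\log_2P|h|^2\right]+\log_2\frac{\pi e}{4}+\log_2c$$ is achievable with the family of lattices $L_k$ over the single antenna fading channel $y_i=h_ix_i+w_i$.
   Context: Channel: a codeword $x=(x_1,\dots,x_k)\in\mathbb{C}^k$ is received as $y_i=h_ix_i+w_i$, $i=1,\dots,k$, where the $w_i$ are i.i.d. circularly symmetric complex Gaussian with mean $0$ and variance $\frac12$ per real dimension, independent of $\{h_i\}$ and of $x$. The receiver (not the transmitter) knows $h_1,\dots,h_k$. Lattices: $\mathbb{C}^k$ is a $2k$-dimensional Euclidean space; a $2k$-dimensional lattice is the $\mathbb{Z}$-span of $2k$ vectors linearly independent over $\mathbb{R}$, and $\mathrm{Vol}(L)$ is the volume of its fundamental parallelotope. The normalized product distance is $\mathrm{Nd}_{p,\min}(L)=\inf_{x\in L\setminus\{0\}}\frac{\prod_{i=1}^k|x_i|}{\mathrm{Vol}(L)^{1/2}}$. Codes: given $P>0$ and a rate $R$, let $C_{1,k}=\frac{(\pi k)^k}{k!}$ and $\alpha>0$ be given by $\alpha^2=\frac{C_{1,k}^{1/k}P}{2^R\,\mathrm{Vol}(L_k)^{1/k}}$.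 With $B(r)$ the closed Euclidean ball of radius $r$ centered at $0$ in $\mathbb{C}^k$, the code is $\mathcal{C}=B(\sqrt{Pk})\cap(x_R+\alpha L_k)$, where $x_R\in\mathbb{C}^k$ is chosen so that $|\mathcal{C}|\ge2^{Rk}$ (such a shift exists). Every codeword satisfies $\frac1k\|x\|^2\le P$. Decoding: the decoder is either maximum likelihood (minimize $\sum_i|y_i-h_ix_i'|^2$ over $x'\in\mathcal{C}$) or naive lattice decoding (minimize the same quantity over the whole shifted lattice $x_R+\alpha L_k$). A rate $R$ is achievable if the probability that the output differs from the transmitted codeword (uniform in $\mathcal{C}$) tends to $0$ as $k\to\infty$. *)

theory Defs
  imports "HOL-Probability.Probability"
begin

section \<open>Vectors and lattices in complex space of dimension k\<close>

text \<open>
  The dimension k has to vary inside a single statement, so vectors are functions on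
  \<open>{..<k}\<close> (coordinates are numbered from 0), extended by \<open>undefined\<close> outside. This is
  the space of the product measure \<open>\<Pi>\<^sub>M i\<in>{..<k}. lborel\<close>. Vector operations have to be
  restricted to \<open>{..<k}\<close> explicitly.
\<close>

type_synonym cvec = "nat \<Rightarrow> complex"

definition cspace :: "nat \<Rightarrow> cvec set" where
  "cspace k = ({..<k} \<rightarrow>\<^sub>E UNIV)"

definition zero_cvec :: "nat \<Rightarrow> cvec" where
  "zero_cvec k = (\<lambda>i\<in>{..<k}. 0)"

definition cnorm :: "nat \<Rightarrow> cvec \<Rightarrow> real" where
  "cnorm k x = L2_set (\<lambda>i. cmod (x i)) {..<k}"

definition closed_ball :: "nat \<Rightarrow> real \<Rightarrow> cvec set" where
  "closed_ball k r = {x \<in> cspace k. cnorm k x \<le> r}"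

definition real_comb :: "nat \<Rightarrow> (nat \<Rightarrow> cvec) \<Rightarrow> (nat \<Rightarrow> real) \<Rightarrow> cvec" where
  "real_comb k b t = (\<lambda>i\<in>{..<k}. \<Sum>j<2*k. complex_of_real (t j) * b j i)"

definition real_independent :: "nat \<Rightarrow> (nat \<Rightarrow> cvec) \<Rightarrow> bool" where
  "real_independent k b \<longleftrightarrow>
     (\<forall>t. real_comb k b t = zero_cvec k \<longrightarrow> (\<forall>j<2*k. t j = 0))"

definition lattice_basis :: "nat \<Rightarrow> cvec set \<Rightarrow> (nat \<Rightarrow> cvec) \<Rightarrow> bool" where
  "lattice_basis k L b \<longleftrightarrow>
     (\<forall>j<2*k. b j \<in> cspace k) \<and> real_independent k b \<and>
     L = {real_comb k b (\<lambda>j. real_of_int (a j)) | a. True}"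

definition full_lattice :: "nat \<Rightarrow> cvec set \<Rightarrow> bool" where
  "full_lattice k L \<longleftrightarrow> (\<exists>b. lattice_basis k L b)"

definition parallelotope :: "nat \<Rightarrow> (nat \<Rightarrow> cvec) \<Rightarrow> cvec set" where
  "parallelotope k b = {real_comb k b t | t. \<forall>j<2*k. 0 \<le> t j \<and> t j < 1}"

text \<open>
  The volume of the parallelotope does not depend on which basis of the lattice is chosen;
  \<open>lborel\<close> on the complex numbers is Lebesgue measure on the plane.
\<close>

definition lattice_vol :: "nat \<Rightarrow> cvec set \<Rightarrow> real" where
  "lattice_vol k L =
     measure (\<Pi>\<^sub>M i\<in>{..<k}. (lborel :: complex measure))
       (parallelotope k (SOME b. lattice_basis k L b))"

definition Nd_p_min :: "nat \<Rightarrow> cvec set \<Rightarrow> real" where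
  "Nd_p_min k L =
     (INF x \<in> L - {zero_cvec k}. (\<Prod>i<k. cmod (x i)) / sqrt (lattice_vol k L))"


section \<open>Codes\<close>

definition C1 :: "nat \<Rightarrow> real" where
  "C1 k = (pi * real k) ^ k / fact k"

definition scaling :: "nat \<Rightarrow> cvec set \<Rightarrow> real \<Rightarrow> real \<Rightarrow> real" where
  "scaling k L P R =
     sqrt (C1 k powr (1 / real k) * P / (2 powr R * lattice_vol k L powr (1 / real k)))"

definition shifted_lattice :: "nat \<Rightarrow> cvec set \<Rightarrow> real \<Rightarrow> real \<Rightarrow> cvec \<Rightarrow> cvec set" where
  "shifted_lattice k L P R xR =
     (\<lambda>v. \<lambda>i\<in>{..<k}. xR i + complex_of_real (scaling k L P R) * v i) ` L"

definition code :: "nat \<Rightarrow> cvec set \<Rightarrow> real \<Rightarrow> real \<Rightarrow> cvec \<Rightarrow> cvec set" where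
  "code k L P R xR = closed_ball k (sqrt (P * real k)) \<inter> shifted_lattice k L P R xR"

definition admissible_shift :: "nat \<Rightarrow> cvec set \<Rightarrow> real \<Rightarrow> real \<Rightarrow> cvec \<Rightarrow> bool" where
  "admissible_shift k L P R xR \<longleftrightarrow>
     xR \<in> cspace k \<and> real (card (code k L P R xR)) \<ge> 2 powr (R * real k)"


section \<open>Channel, decoders and achievable rates\<close>

definition cgaussian_density :: "complex \<Rightarrow> real" where
  "cgaussian_density z =
     normal_density 0 (sqrt (1/2)) (Re z) * normal_density 0 (sqrt (1/2)) (Im z)"

definition received :: "nat \<Rightarrow> cvec \<Rightarrow> cvec \<Rightarrow> cvec \<Rightarrow> cvec" where
  "received k h x w = (\<lambda>i\<in>{..<k}. h i * x i + w i)"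

definition sq_dist :: "nat \<Rightarrow> cvec \<Rightarrow> cvec \<Rightarrow> cvec \<Rightarrow> real" where
  "sq_dist k h y x = (\<Sum>i<k. (cmod (y i - h i * x i))\<^sup>2)"

text \<open>
  A decoder sees the channel coefficients h and the received vector y, and returns a minimizer
  of the squared distance over the search set S. Ties are broken in any measurable way. If S is
  infinite and some coefficient of h vanishes, a minimizer may fail to exist, and the output is
  then an arbitrary element of S.
\<close>

definition min_dist_decoder :: "nat \<Rightarrow> cvec set \<Rightarrow> (cvec \<Rightarrow> cvec \<Rightarrow> cvec) \<Rightarrow> bool" where
  "min_dist_decoder k S D \<longleftrightarrow>
     (\<lambda>(h, y). D h y) \<in>
       (\<Pi>\<^sub>M i\<in>{..<k}. (borel :: complex measure)) \<Otimes>\<^sub>M (\<Pi>\<^sub>M i\<in>{..<k}. (borel :: complex measure))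
         \<rightarrow>\<^sub>M count_space S \<and>
     (\<forall>h \<in> cspace k. \<forall>y \<in> cspace k.
        (\<exists>x. is_arg_min (sq_dist k h y) (\<lambda>x'. x' \<in> S) x) \<longrightarrow>
        is_arg_min (sq_dist k h y) (\<lambda>x'. x' \<in> S) (D h y))"

definition max_likelihood_decoder ::
  "nat \<Rightarrow> cvec set \<Rightarrow> real \<Rightarrow> real \<Rightarrow> cvec \<Rightarrow> (cvec \<Rightarrow> cvec \<Rightarrow> cvec) \<Rightarrow> bool" where
  "max_likelihood_decoder k L P R xR D \<longleftrightarrow> min_dist_decoder k (code k L P R xR) D"

definition naive_lattice_decoder ::
  "nat \<Rightarrow> cvec set \<Rightarrow> real \<Rightarrow> real \<Rightarrow> cvec \<Rightarrow> (cvec \<Rightarrow> cvec \<Rightarrow> cvec) \<Rightarrow> bool" where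
  "naive_lattice_decoder k L P R xR D \<longleftrightarrow> min_dist_decoder k (shifted_lattice k L P R xR) D"

text \<open>
  The product with the uniform measure makes the transmitted codeword uniform on the code C and
  independent of the channel and the noise.
\<close>

definition error_prob ::
  "'a measure \<Rightarrow> (nat \<Rightarrow> 'a \<Rightarrow> complex) \<Rightarrow> (nat \<Rightarrow> 'a \<Rightarrow> complex) \<Rightarrow> nat \<Rightarrow> cvec set \<Rightarrow>
     (cvec \<Rightarrow> cvec \<Rightarrow> cvec) \<Rightarrow> real" where
  "error_prob M h w k C D =
     measure (uniform_count_measure C \<Otimes>\<^sub>M M)
       {(x, \<omega>) \<in> C \<times> space M.
          D (\<lambda>i\<in>{..<k}. h i \<omega>) (received k (\<lambda>i. h i \<omega>) x (\<lambda>i. w i \<omega>)) \<noteq> x}"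

text \<open>
  Achievability of the rate R with the family \<open>L k\<close> indexed by the dimensions k in K, for a
  class Dec of decoders: the codes and decoders exist in each dimension, and whichever
  admissible shifts and decoders are chosen, the error probability tends to 0 as k tends to
  infinity inside K.
\<close>

definition achievable ::
  "'a measure \<Rightarrow> (nat \<Rightarrow> 'a \<Rightarrow> complex) \<Rightarrow> (nat \<Rightarrow> 'a \<Rightarrow> complex) \<Rightarrow> nat set \<Rightarrow> (nat \<Rightarrow> cvec set) \<Rightarrow>
     real \<Rightarrow> (nat \<Rightarrow> cvec set \<Rightarrow> real \<Rightarrow> real \<Rightarrow> cvec \<Rightarrow> (cvec \<Rightarrow> cvec \<Rightarrow> cvec) \<Rightarrow> bool) \<Rightarrow> real \<Rightarrow> bool"
  where
  "achievable M h w K L P Dec R \<longleftrightarrow>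
     (\<forall>k\<in>K. \<exists>xR. admissible_shift k (L k) P R xR \<and> (\<exists>D. Dec k (L k) P R xR D)) \<and>
     (\<forall>xR D. (\<forall>k\<in>K. admissible_shift k (L k) P R (xR k) \<and> Dec k (L k) P R (xR k) (D k)) \<longrightarrow>
        ((\<lambda>k. error_prob M h w k (code k (L k) P R (xR k)) (D k)) \<longlongrightarrow> 0)
          (inf sequentially (principal K)))"

definition converges_in_prob :: "'a measure \<Rightarrow> (nat \<Rightarrow> 'a \<Rightarrow> real) \<Rightarrow> real \<Rightarrow> bool" where
  "converges_in_prob M X l \<longleftrightarrow>
     (\<forall>\<epsilon>>0. (\<lambda>k. measure M {\<omega> \<in> space M. \<bar>X k \<omega> - l\<bar> > \<epsilon>}) \<longlonglongrightarrow> 0)"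

end

theory Submission
  imports Defs "HOL-Library.Function_Algebras" "HOL-Real_Asymp.Real_Asymp"
begin

text \<open>
  The error event is controlled by a packing argument alone. If a minimum distance decoder errs, the
  noise has at least half the norm of the faded difference of two points of the scaled lattice.
  By AM-GM the square of the latter is at least \<open>k\<close> times the \<open>k\<close>-th root of its squared product
  distance, that is \<open>k * 2 powr S * C1 k powr (1/k) * P / 2 powr R * c\<close>, where \<open>S\<close> is the empirical
  mean of the \<open>log 2 \<bar>h i\<bar>\<^sup>2\<close>. As \<open>C1 k powr (1/k)\<close> tends to \<open>pi * exp 1\<close> by Stirling and the
  noise energy per coordinate concentrates at 1, the rate condition makes errors improbable. The
  shift exists by averaging over a fundamental parallelotope.
\<close>

section \<open>Lattice points and separation by the product distance\<close>

text \<open>The probabilistic part starts only after a deterministic implication: for nonzero fading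
  coefficients, a decoding error forces the noise energy over a threshold that the codeword, the
  shift and the tie-breaking do not affect. The uniform choice of the codeword therefore drops out
  of the error probability, no union bound over codewords is taken, and both decoders are one
  argument with different search sets. Two facts that the encoding does not hand over come from the
  product distance. Its positivity yields positive volume, and with it measurability of the
  parallelotope. Its lower bound on differences yields discreteness: a bounded set of points whose
  differences have products bounded away from 0 is finite. This gives finite codes and the existence
  of nearest lattice points.\<close>

lemma sum_fun_eval: "(\<Sum>v\<in>A. f v) i = (\<Sum>v\<in>A. f v i)"
  for f :: "'b \<Rightarrow> 'c \<Rightarrow> 'd::comm_monoid_add"
  by (induction A rule: infinite_finite_induct) auto

text \<open>Lattices are spans over the reals, so the scalars are real although the entries are
  complex. The carrier is the whole function type, so that one interpretation serves every
  \<open>k\<close>.\<close>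

interpretation cvec: vector_space "\<lambda>(r::real) (x::cvec) i. complex_of_real r * x i"
  by unfold_locales (auto simp: fun_eq_iff algebra_simps)

lemma real_comb_in_cspace [simp]: "real_comb k b t \<in> cspace k"
  by (simp add: real_comb_def cspace_def)

text \<open>Steinitz exchange: the \<open>2*k\<close> independent vectors lie in the span of the at
  most \<open>2*k\<close> vectors in \<open>E\<close>, namely 1 and \<open>\<i>\<close> in each
  coordinate, so a further independent vector would be one too many.\<close>

lemma real_independent_spans:
  assumes ind: "real_independent k b" and x: "x \<in> cspace k"
  obtains t where "x = real_comb k b t"
proof -
  \<comment> \<open>The value \<open>undefined\<close> outside the index range becomes 0, so that
    pointwise addition and scaling respect the range.\<close>
  define T :: "cvec \<Rightarrow> cvec" where "T = (\<lambda>v i. if i < k then v i else 0)"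
  define B where "B = (\<lambda>j. T (b j)) ` {..<2*k}"
  define E :: "cvec set" where
    "E = (\<lambda>j i. if i = j then 1 else 0) ` {..<k} \<union> (\<lambda>j i. if i = j then \<i> else 0) ` {..<k}"
  have finE: "finite E" and cardE: "card E \<le> 2 * k"
  proof -
    show "finite E" by (simp add: E_def)
    have "card E \<le> card ((\<lambda>j i. if i = j then (1::complex) else 0) ` {..<k}) +
                 card ((\<lambda>j i. if i = j then \<i> else 0) ` {..<k})"
      unfolding E_def by (rule card_Un_le)
    also have "\<dots> \<le> k + k"
      by (intro add_mono order.trans[OF card_image_le]) auto
    finally show "card E \<le> 2 * k" by simp
  qed
  have comb0: "t j = 0" if "\<And>i. i < k \<Longrightarrow> (\<Sum>j<2*k. complex_of_real (t j) * b j i) = 0" "j < 2*k" for t j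
    using ind that unfolding real_independent_def real_comb_def zero_cvec_def
    by (metis (mono_tags, lifting) lessThan_iff restrict_ext)
  have inj: "inj_on (\<lambda>j. T (b j)) {..<2*k}"
  proof (rule inj_onI, rule ccontr)
    fix p q assume pq: "p \<in> {..<2*k}" "q \<in> {..<2*k}" "T (b p) = T (b q)" "p \<noteq> q"
    \<comment> \<open>Two equal vectors would satisfy the relation with coefficients 1 and -1.
      Injectivity is what gives \<open>B\<close> exactly \<open>2*k\<close> elements.\<close>
    define t :: "nat \<Rightarrow> real" where "t = (\<lambda>j. if j = p then 1 else if j = q then -1 else 0)"
    have "(\<Sum>j<2*k. complex_of_real (t j) * b j i) = 0" if "i < k" for i
    proof -
      have "(\<Sum>j<2*k. complex_of_real (t j) * b j i) = (\<Sum>j\<in>{p,q}. complex_of_real (t j) * b j i)"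
        using pq by (intro sum.mono_neutral_right) (auto simp: t_def)
      also have "\<dots> = b p i - b q i" using pq by (simp add: t_def)
      also have "\<dots> = 0" using fun_cong[OF pq(3), of i] that by (simp add: T_def)
      finally show ?thesis .
    qed
    from comb0[OF this, of p] pq show False by (simp add: t_def)
  qed
  have sumB: "(\<Sum>v\<in>B. (\<lambda>i. complex_of_real (u v) * v i)) =
      (\<lambda>i. if i < k then \<Sum>j<2*k. complex_of_real (u (T (b j))) * b j i else 0)" for u
  proof
    fix i
    have "(\<Sum>v\<in>B. (\<lambda>i. complex_of_real (u v) * v i)) i = (\<Sum>j<2*k. complex_of_real (u (T (b j))) * T (b j) i)"
      unfolding sum_fun_eval B_def by (subst sum.reindex[OF inj]) simp
    then show "(\<Sum>v\<in>B. (\<lambda>i. complex_of_real (u v) * v i)) i =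
      (if i < k then \<Sum>j<2*k. complex_of_real (u (T (b j))) * b j i else 0)"
      by (simp add: T_def)
  qed
  have finB: "finite B" by (simp add: B_def)
  have indB: "cvec.independent B"
  proof (rule cvec.independent_if_scalars_zero[OF finB])
    fix u v assume 0: "(\<Sum>x\<in>B. (\<lambda>i. complex_of_real (u x) * x i)) = 0" and v: "v \<in> B"
    obtain j where j: "j < 2*k" "v = T (b j)" using v by (auto simp: B_def)
    have "(\<Sum>j<2*k. complex_of_real (u (T (b j))) * b j i) = 0" if "i < k" for i
      using fun_cong[OF 0[unfolded sumB], of i] that by simp
    from comb0[of "\<lambda>j. u (T (b j))", OF this j(1)] j show "u v = 0" by simp
  qed
  have cardB: "card B = 2 * k" unfolding B_def by (simp add: card_image inj)
  have spanE: "T v \<in> cvec.span E" for v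
  proof -
    have "T v = (\<Sum>j<k. (\<lambda>i. complex_of_real (Re (v j)) * (if i = j then 1 else 0)) +
                       (\<lambda>i. complex_of_real (Im (v j)) * (if i = j then \<i> else 0)))"
    proof
      fix i
      show "T v i = (\<Sum>j<k. (\<lambda>i. complex_of_real (Re (v j)) * (if i = j then 1 else 0)) +
                       (\<lambda>i. complex_of_real (Im (v j)) * (if i = j then \<i> else 0))) i"
        unfolding sum_fun_eval
        by (simp add: T_def sum.distrib if_distrib complex_eq mult.commute cong: if_cong)
    qed
    also have "\<dots> \<in> cvec.span E"
      by (intro cvec.span_sum cvec.span_add cvec.span_scale cvec.span_base) (auto simp: E_def)
    finally show ?thesis .
  qed
  have "T x \<in> cvec.span B"
  proof (rule ccontr)
    assume n: "T x \<notin> cvec.span B"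
    then have "T x \<notin> B" using cvec.span_base by blast
    have "cvec.independent (insert (T x) B)" by (rule cvec.independent_insertI[OF n indB])
    moreover have "insert (T x) B \<subseteq> cvec.span E" using spanE by (auto simp: B_def)
    ultimately have "card (insert (T x) B) \<le> card E"
      using cvec.independent_span_bound[OF finE] by blast
    with \<open>T x \<notin> B\<close> finB cardB cardE show False by simp
  qed
  then obtain u where u: "T x = (\<Sum>v\<in>B. (\<lambda>i. complex_of_real (u v) * v i))"
    unfolding cvec.span_finite[OF finB] by blast
  have "x = real_comb k b (\<lambda>j. u (T (b j)))"
  proof
    fix i
    show "x i = real_comb k b (\<lambda>j. u (T (b j))) i"
      using fun_cong[OF u[unfolded sumB], of i] x
      by (cases "i < k") (auto simp: T_def real_comb_def cspace_def)
  qed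
  then show thesis by (rule that)
qed

lemma real_comb_diff:
  "(\<lambda>i\<in>{..<k}. real_comb k b s i - real_comb k b t i) = real_comb k b (\<lambda>j. s j - t j)"
  by (auto simp: real_comb_def fun_eq_iff sum_subtractf algebra_simps)

lemma lattice_diff:
  assumes "full_lattice k L" "u \<in> L" "v \<in> L"
  shows "(\<lambda>i\<in>{..<k}. u i - v i) \<in> L"
proof -
  obtain b where L: "L = {real_comb k b (\<lambda>j. real_of_int (a j)) | a. True}"
    using assms(1) unfolding full_lattice_def lattice_basis_def by blast
  obtain a a' where "u = real_comb k b (\<lambda>j. real_of_int (a j))" "v = real_comb k b (\<lambda>j. real_of_int (a' j))"
    using assms L by blast
  then have "(\<lambda>i\<in>{..<k}. u i - v i) = real_comb k b (\<lambda>j. real_of_int (a j - a' j))"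
    by (simp add: real_comb_diff)
  then show ?thesis unfolding L by (intro CollectI exI[of _ "\<lambda>j. a j - a' j"]) simp
qed

lemma lattice_subset_cspace: "full_lattice k L \<Longrightarrow> L \<subseteq> cspace k"
  unfolding full_lattice_def lattice_basis_def by auto

lemma countable_lattice:
  assumes "full_lattice k L"
  shows "countable L"
proof -
  obtain b where L: "L = {real_comb k b (\<lambda>j. real_of_int (a j)) | a. True}"
    using assms(1) unfolding full_lattice_def lattice_basis_def by blast
  \<comment> \<open>The coefficient sequences \<open>a\<close> are infinite, hence uncountably many,
    but only their first \<open>2*k\<close> entries matter.\<close>
  have "L \<subseteq> (\<lambda>a. real_comb k b (\<lambda>j. real_of_int (a j))) ` ({..<2*k} \<rightarrow>\<^sub>E UNIV)"
  proof
    fix v assume "v \<in> L"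
    then obtain a where a: "v = real_comb k b (\<lambda>j. real_of_int (a j))" unfolding L by blast
    have "v = real_comb k b (\<lambda>j. real_of_int (restrict a {..<2*k} j))"
      unfolding a real_comb_def by (intro restrict_ext sum.cong) auto
    then show "v \<in> (\<lambda>a. real_comb k b (\<lambda>j. real_of_int (a j))) ` ({..<2*k} \<rightarrow>\<^sub>E UNIV)"
      by (rule image_eqI[where x="restrict a {..<2*k}"]) simp
  qed
  moreover have "countable ({..<2*k} \<rightarrow>\<^sub>E (UNIV :: int set))"
    by (intro countable_PiE) auto
  ultimately show ?thesis by (meson countable_image countable_subset)
qed

text \<open>Keeps the set under the infimum in \<open>Nd_p_min\<close> nonempty; the infimum of an
  empty set of reals would carry no information.\<close>

lemma lattice_nontrivial:
  assumes "full_lattice k L" "k \<ge> 1"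
  shows "L - {zero_cvec k} \<noteq> {}"
proof -
  obtain b where ind: "real_independent k b" and L: "L = {real_comb k b (\<lambda>j. real_of_int (a j)) | a. True}"
    using assms(1) unfolding full_lattice_def lattice_basis_def by blast
  define a :: "nat \<Rightarrow> int" where "a = (\<lambda>_. 1)"
  have "real_comb k b (\<lambda>j. real_of_int (a j)) \<noteq> zero_cvec k"
  proof
    assume "real_comb k b (\<lambda>j. real_of_int (a j)) = zero_cvec k"
    then have "real_of_int (a 0) = 0" using ind assms(2) unfolding real_independent_def by fastforce
    then show False by (simp add: a_def)
  qed
  then show ?thesis unfolding L by blast
qed

text \<open>Rounding the real coordinates of \<open>x\<close> down leaves fractional parts in [0,1).
  This is the half of the tiling property on which the averaging argument rests.\<close>

lemma lattice_covering:
  assumes b: "lattice_basis k L b" and x: "x \<in> cspace k"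
  obtains v where "v \<in> L" "(\<lambda>i\<in>{..<k}. x i - v i) \<in> parallelotope k b"
proof -
  obtain t where t: "x = real_comb k b t"
    using real_independent_spans x b unfolding lattice_basis_def by blast
  show thesis
  proof
    show "real_comb k b (\<lambda>j. real_of_int \<lfloor>t j\<rfloor>) \<in> L"
      using b unfolding lattice_basis_def by auto
    show "(\<lambda>i\<in>{..<k}. x i - real_comb k b (\<lambda>j. real_of_int \<lfloor>t j\<rfloor>) i) \<in> parallelotope k b"
      unfolding t real_comb_diff parallelotope_def
      by (intro CollectI exI[of _ "\<lambda>j. t j - of_int \<lfloor>t j\<rfloor>"]) (auto, linarith)
  qed
qed

text \<open>Pigeonhole on a grid: boundedness leaves finitely many cells, and two points in one cell
  differ by little in every coordinate, against the lower bound on the product.\<close>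

lemma finite_product_separated:
  assumes k: "k \<ge> 1" and X: "X \<subseteq> cspace k" and \<delta>: "\<delta> > 0"
    and sep: "\<And>x y. x \<in> X \<Longrightarrow> y \<in> X \<Longrightarrow> x \<noteq> y \<Longrightarrow> (\<Prod>i<k. cmod (x i - y i)) \<ge> \<delta>"
    and bdd: "\<And>x i. x \<in> X \<Longrightarrow> i < k \<Longrightarrow> cmod (x i) \<le> r"
  shows "finite X"
proof -
  \<comment> \<open>Then \<open>2 * \<eta>\<close> is at most 1/2 and less than
    \<open>\<delta>\<close>; being below 1, its \<open>k\<close>-th power does not exceed
    it.\<close>
  define \<eta> where "\<eta> = min 1 \<delta> / 4"
  have \<eta>: "\<eta> > 0" using \<delta> by (simp add: \<eta>_def)
  define g where "g = (\<lambda>x::cvec. \<lambda>i\<in>{..<k}. (\<lfloor>Re (x i) / \<eta>\<rfloor>, \<lfloor>Im (x i) / \<eta>\<rfloor>))"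
  define m where "m = \<lceil>r / \<eta>\<rceil> + 1"
  have "g ` X \<subseteq> {..<k} \<rightarrow>\<^sub>E ({-m..m} \<times> {-m..m})"
  proof -
    have "\<lfloor>a / \<eta>\<rfloor> \<in> {-m..m}" if "\<bar>a\<bar> \<le> r" for a
    proof -
      have "a / \<eta> \<le> r / \<eta>" "-(r / \<eta>) \<le> a / \<eta>"
        using that \<eta> by (auto simp: divide_simps)
      then show ?thesis unfolding m_def atLeastAtMost_iff by linarith
    qed
    moreover have "\<bar>Re (x i)\<bar> \<le> r" "\<bar>Im (x i)\<bar> \<le> r" if "x \<in> X" "i < k" for x i
      using bdd[OF that] abs_Re_le_cmod[of "x i"] abs_Im_le_cmod[of "x i"] by linarith+
    ultimately show ?thesis unfolding g_def by (auto split: if_splits)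
  qed
  then have "finite (g ` X)" by (rule finite_subset) (auto intro!: finite_PiE)
  moreover have "inj_on g X"
  proof (rule inj_onI, rule ccontr)
    fix x y assume xy: "x \<in> X" "y \<in> X" "g x = g y" "x \<noteq> y"
    have "cmod (x i - y i) \<le> 2 * \<eta>" if "i < k" for i
    proof -
      have eq: "\<lfloor>Re (x i) / \<eta>\<rfloor> = \<lfloor>Re (y i) / \<eta>\<rfloor>" "\<lfloor>Im (x i) / \<eta>\<rfloor> = \<lfloor>Im (y i) / \<eta>\<rfloor>"
        using fun_cong[OF xy(3), of i] that by (auto simp: g_def)
      have close: "\<bar>a - b\<bar> \<le> \<eta>" if "\<lfloor>a / \<eta>\<rfloor> = \<lfloor>b / \<eta>\<rfloor>" for a b
      proof -
        have "\<bar>a / \<eta> - b / \<eta>\<bar> \<le> 1" using that by linarith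
        then have "\<bar>a / \<eta> - b / \<eta>\<bar> * \<eta> \<le> 1 * \<eta>" using \<eta> by (intro mult_right_mono) auto
        also have "\<bar>a / \<eta> - b / \<eta>\<bar> * \<eta> = \<bar>(a / \<eta> - b / \<eta>) * \<eta>\<bar>"
          using \<eta> by (simp add: abs_mult)
        also have "(a / \<eta> - b / \<eta>) * \<eta> = a - b" using \<eta> by (simp add: field_simps)
        finally show ?thesis by simp
      qed
      show ?thesis
        using cmod_le[of "x i - y i"] close[OF eq(1)] close[OF eq(2)] by simp
    qed
    then have "(\<Prod>i<k. cmod (x i - y i)) \<le> (\<Prod>i<k. 2 * \<eta>)" by (intro prod_mono) auto
    also have "\<dots> = (2 * \<eta>) ^ k" by simp
    also have "\<dots> \<le> (2 * \<eta>) ^ 1" using k \<eta> by (intro power_decreasing) (auto simp: \<eta>_def)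
    also have "\<dots> < \<delta>" using \<delta> by (auto simp: \<eta>_def min_def)
    finally show False using sep[OF xy(1,2,4)] by simp
  qed
  ultimately show ?thesis by (rule finite_imageD)
qed

section \<open>Lebesgue measure on complex space\<close>

abbreviation cmeasure :: "nat \<Rightarrow> cvec measure" where
  "cmeasure k \<equiv> \<Pi>\<^sub>M i\<in>{..<k}. (lborel :: complex measure)"

interpretation lborel_prod: product_sigma_finite "\<lambda>_::nat. lborel :: complex measure"
  by standard

lemma space_cmeasure: "space (cmeasure k) = cspace k"
  by (simp add: space_PiM cspace_def)

lemma measurable_translate [measurable]:
  "(\<lambda>x. \<lambda>i\<in>{..<k}. x i + v i) \<in> cmeasure k \<rightarrow>\<^sub>M cmeasure k"
  by measurable

lemma distr_cmeasure_translate: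
  "distr (cmeasure k) (cmeasure k) (\<lambda>x. \<lambda>i\<in>{..<k}. x i + v i) = cmeasure k"
proof (rule lborel_prod.PiM_eqI)
  fix A :: "nat \<Rightarrow> complex set" assume A: "\<And>i. i \<in> {..<k} \<Longrightarrow> A i \<in> sets lborel"
  have *: "(\<lambda>x. \<lambda>i\<in>{..<k}. x i + v i) -` Pi\<^sub>E {..<k} A \<inter> space (cmeasure k) =
        Pi\<^sub>E {..<k} (\<lambda>i. (+) (v i) -` A i)"
    by (auto simp: space_PiM PiE_def Pi_def add.commute)
  have tr: "emeasure lborel ((+) (v i) -` A i) = emeasure lborel (A i)"
    and ms: "(+) (v i) -` A i \<in> sets lborel" if "i < k" for i
  proof -
    show "(+) (v i) -` A i \<in> sets lborel"
      using A[of i] that measurable_sets[of "(+) (v i)" borel borel "A i"] by simp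
    show "emeasure lborel ((+) (v i) -` A i) = emeasure lborel (A i)"
      using A[of i] that
      by (subst (2) lborel_distr_plus[of "v i", symmetric], subst emeasure_distr) auto
  qed
  have "emeasure (distr (cmeasure k) (cmeasure k) (\<lambda>x. \<lambda>i\<in>{..<k}. x i + v i)) (Pi\<^sub>E {..<k} A) =
        emeasure (cmeasure k) (Pi\<^sub>E {..<k} (\<lambda>i. (+) (v i) -` A i))"
    using A by (subst emeasure_distr) (auto simp: * intro!: sets_PiM_I_finite)
  also have "\<dots> = (\<Prod>i<k. emeasure lborel (A i))"
    using tr ms by (subst lborel_prod.emeasure_PiM) auto
  finally show "emeasure (distr (cmeasure k) (cmeasure k) (\<lambda>x. \<lambda>i\<in>{..<k}. x i + v i)) (Pi\<^sub>E {..<k} A) =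
       (\<Prod>i<k. emeasure lborel (A i))" .
qed auto

section \<open>Squared moduli and ball volumes\<close>

text \<open>A disc of squared radius \<open>a\<close> has area pi times \<open>a\<close>, so the
  squared modulus has constant density pi on the half-line. This turns both the ball volume and the
  law of the noise energy into one-dimensional integrals.\<close>

lemma distr_lborel_cmod_square:
  "distr (lborel :: complex measure) borel (\<lambda>z. (cmod z)\<^sup>2) =
     density lborel (\<lambda>s. ennreal (pi * indicator {0..} s))" (is "?M = ?N")
proof (rule measure_eqI_generator_eq[where E="range atMost" and \<Omega>=UNIV and A="\<lambda>n. {..real n}"])
  show "Int_stable (range atMost :: real set set)"
    by (auto simp: Int_stable_def)
  have M: "emeasure ?M {..a} = ennreal (pi * max 0 a)" for a
  proof (cases "a \<ge> 0")
    case True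
    have "emeasure ?M {..a} = emeasure lborel ((\<lambda>z::complex. (cmod z)\<^sup>2) -` {..a})"
      by (subst emeasure_distr) auto
    also have "(\<lambda>z::complex. (cmod z)\<^sup>2) -` {..a} = cball 0 (sqrt a)"
      using True by (auto simp: sqrt_le_D real_le_rsqrt) (metis norm_ge_zero real_sqrt_le_iff real_sqrt_unique sqrt_le_D real_le_rsqrt)
    also have "emeasure lborel (cball (0::complex) (sqrt a)) = ennreal (unit_ball_vol 2 * sqrt a ^ 2)"
      using True by (subst emeasure_cball) (auto simp: DIM_complex)
    also have "\<dots> = ennreal (pi * max 0 a)" using True by (simp add: unit_ball_vol_2)
    finally show ?thesis .
  next
    case False
    then have "(\<lambda>z::complex. (cmod z)\<^sup>2) -` {..a} = {}"
      by (auto simp: not_le dest: order.strict_trans1[OF order.trans[OF zero_le_power2]])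
    then show ?thesis using False by (subst emeasure_distr) auto
  qed
  have N: "emeasure ?N {..a} = ennreal (pi * max 0 a)" for a
  proof -
    have "emeasure ?N {..a} = (\<integral>\<^sup>+ s. ennreal pi * indicator {0..a} s \<partial>lborel)"
      by (subst emeasure_density) (auto intro!: nn_integral_cong simp: indicator_def)
    also have "\<dots> = ennreal pi * emeasure lborel {0..a}"
      by (subst nn_integral_cmult) auto
    also have "\<dots> = ennreal (pi * max 0 a)"
      by (simp add: emeasure_lborel_Icc_eq ennreal_mult'' max_def)
    finally show ?thesis .
  qed
  show "emeasure ?M X = emeasure ?N X" if "X \<in> range atMost" for X using that M N by auto
  have "sets borel = sigma_sets UNIV (range atMost :: real set set)"
    by (subst borel_eq_atMost) (simp add: full_SetCompr_eq)
  then show "sets ?M = sigma_sets UNIV (range atMost)" "sets ?N = sigma_sets UNIV (range atMost)" by simp_all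
  show "(\<Union>i. {..real i}) = UNIV" using real_arch_simple by auto
  show "emeasure ?M {..real i} \<noteq> \<infinity>" for i by (simp add: M)
qed auto

lemma nn_integral_cmod_square:
  assumes [measurable]: "f \<in> borel_measurable borel"
  shows "(\<integral>\<^sup>+ z. f ((cmod z)\<^sup>2) \<partial>lborel) = (\<integral>\<^sup>+ s. ennreal (pi * indicator {0..} s) * f s \<partial>lborel)"
proof -
  have "(\<integral>\<^sup>+ z. f ((cmod z)\<^sup>2) \<partial>lborel) = (\<integral>\<^sup>+ s. f s \<partial>distr (lborel :: complex measure) borel (\<lambda>z. (cmod z)\<^sup>2))"
    by (subst nn_integral_distr) auto
  then show ?thesis
    unfolding distr_lborel_cmod_square by (simp add: nn_integral_density)
qed

lemma sets_sum_cmod_le [measurable]: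
  "{x \<in> cspace k. (\<Sum>i<k. (cmod (x i))\<^sup>2) \<le> t} \<in> sets (cmeasure k)"
proof -
  have "{x \<in> space (cmeasure k). (\<Sum>i<k. (cmod (x i))\<^sup>2) \<le> t} \<in> sets (cmeasure k)"
    by measurable
  then show ?thesis by (simp add: space_cmeasure)
qed

text \<open>Fibre over the last coordinate: if its squared modulus is \<open>s\<close>, the other
  coordinates fill a ball of squared radius \<open>t - s\<close>, and integrating that volume
  against the density pi raises the power by one. Using the squared radius keeps the recursion
  polynomial.\<close>

lemma emeasure_cmeasure_ball:
  assumes "t \<ge> 0"
  shows "emeasure (cmeasure k) {x \<in> cspace k. (\<Sum>i<k. (cmod (x i))\<^sup>2) \<le> t} = ennreal ((pi * t) ^ k / fact k)"
  using assms
proof (induction k arbitrary: t)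
  case 0
  then show ?case by (simp add: PiM_empty cspace_def)
next
  case (Suc k)
  let ?S = "\<lambda>k t. {x \<in> cspace k. (\<Sum>i<k. (cmod (x i))\<^sup>2) \<le> t}"
  have eq: "indicator (?S (Suc k) t) (x(k := z)) =
      (indicator {..t} ((cmod z)\<^sup>2) * indicator (?S k (t - (cmod z)\<^sup>2)) x :: ennreal)" if "x \<in> cspace k" for x z
  proof -
    have "x(k := z) \<in> cspace (Suc k)" using that
      by (auto simp: cspace_def PiE_def extensional_def)
    moreover have "(\<Sum>i<Suc k. (cmod ((x(k := z)) i))\<^sup>2) = (\<Sum>i<k. (cmod (x i))\<^sup>2) + (cmod z)\<^sup>2"
      by simp
    moreover have "(\<Sum>i<k. (cmod (x i))\<^sup>2) \<ge> 0" by (intro sum_nonneg) auto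
    ultimately show ?thesis using that by (auto simp: indicator_def)
  qed
  have "emeasure (cmeasure (Suc k)) (?S (Suc k) t) = (\<integral>\<^sup>+ x. indicator (?S (Suc k) t) x \<partial>PiM (insert k {..<k}) (\<lambda>_. lborel))"
    unfolding lessThan_Suc[symmetric] by (rule nn_integral_indicator[symmetric]) (rule sets_sum_cmod_le)
  also have "\<dots> = (\<integral>\<^sup>+ z. \<integral>\<^sup>+ x. indicator (?S (Suc k) t) (x(k := z)) \<partial>cmeasure k \<partial>lborel)"
    by (intro lborel_prod.product_nn_integral_insert_rev) (auto simp: lessThan_Suc[symmetric] simp del: sum.lessThan_Suc)
  also have "\<dots> = (\<integral>\<^sup>+ z. \<integral>\<^sup>+ x. indicator {..t} ((cmod z)\<^sup>2) * indicator (?S k (t - (cmod z)\<^sup>2)) x \<partial>cmeasure k \<partial>lborel)"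
    using eq by (intro nn_integral_cong) (auto simp: space_cmeasure)
  also have "\<dots> = (\<integral>\<^sup>+ z. indicator {..t} ((cmod z)\<^sup>2) * ennreal ((pi * (t - (cmod z)\<^sup>2)) ^ k / fact k) \<partial>lborel)"
  proof (rule nn_integral_cong)
    fix z :: complex
    have "(\<integral>\<^sup>+ x. indicator {..t} ((cmod z)\<^sup>2) * indicator (?S k (t - (cmod z)\<^sup>2)) x \<partial>cmeasure k) =
        indicator {..t} ((cmod z)\<^sup>2) * emeasure (cmeasure k) (?S k (t - (cmod z)\<^sup>2))"
      by (subst nn_integral_cmult) auto
    then show "(\<integral>\<^sup>+ x. indicator {..t} ((cmod z)\<^sup>2) * indicator (?S k (t - (cmod z)\<^sup>2)) x \<partial>cmeasure k) =
        indicator {..t} ((cmod z)\<^sup>2) * ennreal ((pi * (t - (cmod z)\<^sup>2)) ^ k / fact k)"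
      using Suc.IH[of "t - (cmod z)\<^sup>2"] by (simp add: indicator_def)
  qed
  also have "\<dots> = (\<integral>\<^sup>+ s. ennreal (pi * indicator {0..} s) * (indicator {..t} s * ennreal ((pi * (t - s)) ^ k / fact k)) \<partial>lborel)"
    by (subst nn_integral_cmod_square[symmetric]) auto
  also have "\<dots> = (\<integral>\<^sup>+ s. ennreal (pi ^ Suc k * (t - s) ^ k / fact k) * indicator {0..t} s \<partial>lborel)"
    by (intro nn_integral_cong) (auto simp: indicator_def ennreal_mult'[symmetric] power_mult_distrib)
  also have "\<dots> = ennreal (- (pi ^ Suc k * (t - t) ^ Suc k / fact (Suc k)) - (- (pi ^ Suc k * (t - 0) ^ Suc k / fact (Suc k))))"
  proof (rule nn_integral_FTC_Icc)
    fix s assume "s \<in> {0..t}"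
    define C where "C = pi ^ Suc k / fact k"
    have deriv: "((\<lambda>s. - (C / Suc k) * (t - s) ^ Suc k) has_real_derivative - (C / Suc k) * (real (Suc k) * (t - s) ^ k * (- 1))) (at s)"
      by (auto intro!: derivative_eq_intros simp del: power_Suc)
    have val: "- (C / Suc k) * (real (Suc k) * (t - s) ^ k * (- 1)) = pi ^ Suc k * (t - s) ^ k / fact k"
      by (simp add: C_def del: power_Suc of_nat_Suc)
    have fn: "(\<lambda>s. - (C / Suc k) * (t - s) ^ Suc k) = (\<lambda>s. - (pi ^ Suc k * (t - s) ^ Suc k / fact (Suc k)))"
      by (simp add: C_def fun_eq_iff del: power_Suc of_nat_Suc)
    show "((\<lambda>s. - (pi ^ Suc k * (t - s) ^ Suc k / fact (Suc k))) has_real_derivative pi ^ Suc k * (t - s) ^ k / fact k) (at s)"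
      using deriv unfolding val fn .
    show "0 \<le> pi ^ Suc k * (t - s) ^ k / fact k" using \<open>s \<in> {0..t}\<close> by auto
  qed (use Suc.prems in auto)
  also have "\<dots> = ennreal ((pi * t) ^ Suc k / fact (Suc k))"
    by (simp add: power_mult_distrib mult_ac del: fact_Suc)
  finally show ?case .
qed

section \<open>Shifts with many codewords\<close>

text \<open>Averaging as in Blichfeldt's theorem: the number of points \<open>x + v\<close> in
  \<open>B\<close>, integrated over \<open>x\<close> in the parallelotope, is at least the volume of
  \<open>B\<close>, so some \<open>x\<close> reaches the mean. Finiteness makes \<open>card\<close>
  a true count, since it is 0 on infinite sets.\<close>

lemma exists_translate_card_ge:
  assumes b: "lattice_basis k L b"
    and V: "measure (cmeasure k) (parallelotope k b) > 0"
    and B: "B \<in> sets (cmeasure k)"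
    and vol: "emeasure (cmeasure k) B \<ge> ennreal (N * measure (cmeasure k) (parallelotope k b))"
    and N: "N > 0"
    and fin: "\<And>x. x \<in> cspace k \<Longrightarrow> finite {v \<in> L. (\<lambda>i\<in>{..<k}. x i + v i) \<in> B}"
  obtains x where "x \<in> cspace k" "real (card {v \<in> L. (\<lambda>i\<in>{..<k}. x i + v i) \<in> B}) \<ge> N"
proof -
  let ?F = "parallelotope k b"
  let ?\<mu> = "cmeasure k"
  have full: "full_lattice k L" using b by (auto simp: full_lattice_def)
  have L: "countable L" "L \<subseteq> cspace k"
    using countable_lattice[OF full] lattice_subset_cspace[OF full] by auto
  \<comment> \<open>a set outside the sigma-algebra would have measure 0\<close>
  have [measurable]: "?F \<in> sets ?\<mu>"
    using V by (metis measure_notin_sets order_less_irrefl)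
  note [measurable] = B
  have emF: "emeasure ?\<mu> ?F = ennreal (measure ?\<mu> ?F)"
    using V by (metis emeasure_eq_ennreal_measure enn2real_top measure_def order_less_irrefl)
  have "\<exists>x\<in>cspace k. real (card {v \<in> L. (\<lambda>i\<in>{..<k}. x i + v i) \<in> B}) \<ge> N"
  proof (rule ccontr)
    assume "\<not> ?thesis"
    then have less: "real (card {v \<in> L. (\<lambda>i\<in>{..<k}. x i + v i) \<in> B}) < N" if "x \<in> cspace k" for x
      using that by (auto simp: not_le)
    \<comment> \<open>The largest integer below \<open>N\<close>. All counts are at most
      \<open>m\<close>, which turns pointwise strict inequalities into a strict one between
      integrals.\<close>
    define m where "m = nat (\<lceil>N\<rceil> - 1)"
    have m: "real m < N" using N by (simp add: m_def) linarith
    have le_m: "card {v \<in> L. (\<lambda>i\<in>{..<k}. x i + v i) \<in> B} \<le> m" if "x \<in> cspace k" for x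
      using less[OF that] unfolding m_def by linarith
    \<comment> \<open>Records that \<open>y\<close> lies in \<open>B\<close> and in the cell
      translated by \<open>v\<close>. By covering, each \<open>y\<close> in \<open>B\<close> has
      some \<open>v\<close> for which this is 1.\<close>
    let ?g = "\<lambda>v y. indicator B y * indicator ?F (\<lambda>i\<in>{..<k}. y i - v i) :: ennreal"
    have gmeas [measurable]: "?g v \<in> borel_measurable ?\<mu>" for v
    proof -
      have [measurable]: "(\<lambda>y. \<lambda>i\<in>{..<k}. y i - v i) \<in> ?\<mu> \<rightarrow>\<^sub>M ?\<mu>"
        using measurable_translate[where k=k and v="\<lambda>i. - v i"] by simp
      show ?thesis by measurable
    qed
    have "emeasure ?\<mu> B = (\<integral>\<^sup>+ y. indicator B y \<partial>?\<mu>)" by simp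
    also have "\<dots> \<le> (\<integral>\<^sup>+ y. \<integral>\<^sup>+ v. ?g v y \<partial>count_space L \<partial>?\<mu>)"
    proof (rule nn_integral_mono)
      fix y assume "y \<in> space ?\<mu>"
      then have "y \<in> cspace k" by (simp add: space_cmeasure)
      then obtain v where v: "v \<in> L" "(\<lambda>i\<in>{..<k}. y i - v i) \<in> ?F"
        using lattice_covering[OF b] by blast
      have "indicator B y = ?g v y" using v by simp
      also have "\<dots> = (\<integral>\<^sup>+ u. ?g v y * indicator {v} u \<partial>count_space L)"
        using v by (simp add: nn_integral_cmult)
      also have "\<dots> \<le> (\<integral>\<^sup>+ u. ?g u y \<partial>count_space L)"
        by (intro nn_integral_mono) (auto simp: indicator_def)
      finally show "indicator B y \<le> (\<integral>\<^sup>+ u. ?g u y \<partial>count_space L)" .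
    qed
    also have "\<dots> = (\<integral>\<^sup>+ v. \<integral>\<^sup>+ y. ?g v y \<partial>?\<mu> \<partial>count_space L)"
      by (rule nn_integral_count_space_nn_integral) (use L in auto)
    \<comment> \<open>Translation by \<open>v\<close> moves every cell back onto the parallelotope,
      where the sum over \<open>v\<close> becomes the count bounded by \<open>m\<close>.\<close>
    also have "\<dots> = (\<integral>\<^sup>+ v. \<integral>\<^sup>+ x. indicator B (\<lambda>i\<in>{..<k}. x i + v i) * indicator ?F x \<partial>?\<mu> \<partial>count_space L)"
    proof (rule nn_integral_cong)
      fix v
      have "(\<integral>\<^sup>+ y. ?g v y \<partial>?\<mu>) = (\<integral>\<^sup>+ y. ?g v y \<partial>distr ?\<mu> ?\<mu> (\<lambda>x. \<lambda>i\<in>{..<k}. x i + v i))"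
        by (simp add: distr_cmeasure_translate)
      also have "\<dots> = (\<integral>\<^sup>+ x. ?g v (\<lambda>i\<in>{..<k}. x i + v i) \<partial>?\<mu>)"
        by (subst nn_integral_distr) auto
      also have "\<dots> = (\<integral>\<^sup>+ x. indicator B (\<lambda>i\<in>{..<k}. x i + v i) * indicator ?F x \<partial>?\<mu>)"
      proof (rule nn_integral_cong)
        fix x assume "x \<in> space ?\<mu>"
        then have "(\<lambda>i\<in>{..<k}. (\<lambda>i\<in>{..<k}. x i + v i) i - v i) = x"
          by (auto simp: space_cmeasure cspace_def fun_eq_iff PiE_def extensional_def)
        then show "?g v (\<lambda>i\<in>{..<k}. x i + v i) = indicator B (\<lambda>i\<in>{..<k}. x i + v i) * indicator ?F x" by simp
      qed
      finally show "(\<integral>\<^sup>+ y. ?g v y \<partial>?\<mu>) = (\<integral>\<^sup>+ x. indicator B (\<lambda>i\<in>{..<k}. x i + v i) * indicator ?F x \<partial>?\<mu>)" .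
    qed
    also have "\<dots> = (\<integral>\<^sup>+ x. \<integral>\<^sup>+ v. indicator B (\<lambda>i\<in>{..<k}. x i + v i) * indicator ?F x \<partial>count_space L \<partial>?\<mu>)"
      by (rule nn_integral_count_space_nn_integral[symmetric]) (use L in auto)
    also have "\<dots> \<le> (\<integral>\<^sup>+ x. of_nat m * indicator ?F x \<partial>?\<mu>)"
    proof (rule nn_integral_mono)
      fix x assume "x \<in> space ?\<mu>"
      then have x: "x \<in> cspace k" by (simp add: space_cmeasure)
      have "(\<integral>\<^sup>+ v. indicator B (\<lambda>i\<in>{..<k}. x i + v i) * indicator ?F x \<partial>count_space L) =
          (\<integral>\<^sup>+ v. indicator {v \<in> L. (\<lambda>i\<in>{..<k}. x i + v i) \<in> B} v \<partial>count_space L) * indicator ?F x"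
        by (subst nn_integral_multc[symmetric]) (auto intro!: nn_integral_cong simp: indicator_def)
      also have "(\<integral>\<^sup>+ v. indicator {v \<in> L. (\<lambda>i\<in>{..<k}. x i + v i) \<in> B} v \<partial>count_space L) =
          of_nat (card {v \<in> L. (\<lambda>i\<in>{..<k}. x i + v i) \<in> B})"
        using fin[OF x] by (subst nn_integral_indicator) (auto simp: emeasure_count_space)
      also have "\<dots> * indicator ?F x \<le> of_nat m * indicator ?F x"
        using le_m[OF x] by (intro mult_right_mono) auto
      finally show "(\<integral>\<^sup>+ v. indicator B (\<lambda>i\<in>{..<k}. x i + v i) * indicator ?F x \<partial>count_space L) \<le> of_nat m * indicator ?F x" .
    qed
    also have "\<dots> = ennreal (real m * measure ?\<mu> ?F)"
      by (simp add: nn_integral_cmult emF ennreal_mult ennreal_of_nat_eq_real_of_nat)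
    also have "\<dots> < ennreal (N * measure ?\<mu> ?F)"
      using m V N by (intro ennreal_lessI) auto
    finally show False using vol by simp
  qed
  then show thesis using that by blast
qed

section \<open>Minimum product distance of the lattice and of its scaled shifts\<close>

lemma Nd_p_min_nonneg:
  assumes "full_lattice k L" "k \<ge> 1"
  shows "Nd_p_min k L \<ge> 0"
  unfolding Nd_p_min_def using lattice_nontrivial[OF assms]
  by (intro cINF_greatest) (auto intro!: divide_nonneg_nonneg prod_nonneg simp: lattice_vol_def)

text \<open>If the volume were 0, the division by 0 in \<open>Nd_p_min\<close> would make the infimum 0.\<close>
lemma lattice_vol_pos:
  assumes L: "full_lattice k L" "k \<ge> 1" and "Nd_p_min k L > 0"
  shows "lattice_vol k L > 0"
proof (rule ccontr)
  assume "\<not> lattice_vol k L > 0"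
  then have "lattice_vol k L = 0" by (simp add: lattice_vol_def zero_less_measure_iff)
  then have "Nd_p_min k L = (INF x \<in> L - {zero_cvec k}. 0::real)"
    by (simp add: Nd_p_min_def)
  also have "\<dots> = 0" using lattice_nontrivial[OF L] by simp
  finally show False using assms(3) by simp
qed

lemma lattice_prod_diff_ge:
  assumes L: "full_lattice k L" and vol: "lattice_vol k L > 0"
    and uv: "u \<in> L" "v \<in> L" "u \<noteq> v"
  shows "(\<Prod>i<k. cmod (u i - v i)) \<ge> Nd_p_min k L * sqrt (lattice_vol k L)"
proof -
  let ?z = "\<lambda>i\<in>{..<k}. u i - v i"
  have "?z \<noteq> zero_cvec k"
  proof
    assume eq: "?z = zero_cvec k"
    have "u \<in> cspace k" "v \<in> cspace k" using uv lattice_subset_cspace[OF L] by auto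
    then have "u i = v i" for i
      using fun_cong[OF eq, of i]
      by (cases "i < k") (auto simp: zero_cvec_def cspace_def PiE_def extensional_def)
    then show False using uv by auto
  qed
  then have z: "?z \<in> L - {zero_cvec k}" using lattice_diff[OF L] uv by auto
  have "Nd_p_min k L \<le> (\<Prod>i<k. cmod (?z i)) / sqrt (lattice_vol k L)"
    unfolding Nd_p_min_def
    by (rule cINF_lower[OF _ z])
       (auto intro!: bdd_belowI[of _ 0] divide_nonneg_nonneg prod_nonneg simp: lattice_vol_def)
  also have "(\<Prod>i<k. cmod (?z i)) = (\<Prod>i<k. cmod (u i - v i))"
    by (intro prod.cong) auto
  finally show ?thesis using vol by (simp add: field_simps)
qed

lemma C1_pos: "k \<ge> 1 \<Longrightarrow> C1 k > 0"
  by (simp add: C1_def)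

lemma scaling_square:
  assumes "P > 0" "lattice_vol k L > 0"
  shows "(scaling k L P R)\<^sup>2 = C1 k powr (1 / real k) * P / (2 powr R * lattice_vol k L powr (1 / real k))"
  unfolding scaling_def using assms by (intro real_sqrt_pow2) (auto intro!: divide_nonneg_nonneg)

lemma scaling_pos:
  assumes "P > 0" "lattice_vol k L > 0" "k \<ge> 1"
  shows "scaling k L P R > 0"
  unfolding scaling_def using assms C1_pos[of k] by (auto intro!: divide_pos_pos)

lemma shifted_lattice_prod_diff_ge:
  assumes L: "full_lattice k L" and vol: "lattice_vol k L > 0"
    and P: "P > 0" and k: "k \<ge> 1"
    and uv: "u \<in> shifted_lattice k L P R xR" "v \<in> shifted_lattice k L P R xR" "u \<noteq> v"
  shows "(\<Prod>i<k. cmod (u i - v i)) \<ge> scaling k L P R ^ k * (Nd_p_min k L * sqrt (lattice_vol k L))"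
proof -
  have \<alpha>: "scaling k L P R > 0" using scaling_pos P vol k by blast
  obtain u' v' where u'v': "u' \<in> L" "v' \<in> L" "u = (\<lambda>i\<in>{..<k}. xR i + complex_of_real (scaling k L P R) * u' i)"
    "v = (\<lambda>i\<in>{..<k}. xR i + complex_of_real (scaling k L P R) * v' i)"
    using uv unfolding shifted_lattice_def by blast
  have "(\<Prod>i<k. cmod (u i - v i)) = (\<Prod>i<k. scaling k L P R * cmod (u' i - v' i))"
  proof (rule prod.cong)
    fix i assume "i \<in> {..<k}"
    then have "u i - v i = complex_of_real (scaling k L P R) * (u' i - v' i)"
      unfolding u'v' by (simp add: algebra_simps)
    then show "cmod (u i - v i) = scaling k L P R * cmod (u' i - v' i)"
      using \<alpha> by (simp add: norm_mult)
  qed simp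
  also have "\<dots> = scaling k L P R ^ k * (\<Prod>i<k. cmod (u' i - v' i))"
    by (simp add: prod.distrib)
  also have "\<dots> \<ge> scaling k L P R ^ k * (Nd_p_min k L * sqrt (lattice_vol k L))"
    using lattice_prod_diff_ge[OF L vol u'v'(1,2)] \<alpha> u'v' uv(3) by (intro mult_left_mono) auto
  finally show ?thesis .
qed

lemma shifted_lattice_subset_cspace: "shifted_lattice k L P R xR \<subseteq> cspace k"
  unfolding shifted_lattice_def cspace_def by (intro image_subsetI) simp

lemma countable_shifted_lattice: "full_lattice k L \<Longrightarrow> countable (shifted_lattice k L P R xR)"
  unfolding shifted_lattice_def by (intro countable_image countable_lattice)

text \<open>Discreteness, taken from the product distance instead of from a basis. It serves both
  the finiteness of codes and the search for a nearest point.\<close>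

lemma finite_shifted_lattice_bounded:
  assumes L: "full_lattice k L" and vol: "lattice_vol k L > 0" and Nd: "Nd_p_min k L > 0"
    and P: "P > 0" and k: "k \<ge> 1"
    and X: "X \<subseteq> shifted_lattice k L P R xR" and bdd: "\<And>x i. x \<in> X \<Longrightarrow> i < k \<Longrightarrow> cmod (x i) \<le> r"
  shows "finite X"
proof (rule finite_product_separated[OF k])
  show "X \<subseteq> cspace k" using X shifted_lattice_subset_cspace by blast
  show "0 < scaling k L P R ^ k * (Nd_p_min k L * sqrt (lattice_vol k L))"
    using scaling_pos[OF P vol k] Nd vol by simp
qed (use X in \<open>auto intro: bdd shifted_lattice_prod_diff_ge[OF L vol P k]\<close>)

lemma closed_ball_iff: "r \<ge> 0 \<Longrightarrow> x \<in> closed_ball k r \<longleftrightarrow> x \<in> cspace k \<and> (\<Sum>i<k. (cmod (x i))\<^sup>2) \<le> r\<^sup>2"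
  by (auto simp: closed_ball_def cnorm_def L2_set_def real_le_lsqrt sqrt_le_D sum_nonneg)

lemma cmod_le_of_sum_square_le:
  fixes k :: nat
  assumes "(\<Sum>i<k. (cmod (x i))\<^sup>2) \<le> t" "i < k"
  shows "cmod (x i) \<le> sqrt t"
proof -
  have "(cmod (x i))\<^sup>2 \<le> (\<Sum>i<k. (cmod (x i))\<^sup>2)"
    using assms by (intro member_le_sum) auto
  then show ?thesis using assms by (intro real_le_rsqrt) auto
qed

lemma finite_code:
  assumes L: "full_lattice k L" and vol: "lattice_vol k L > 0" and Nd: "Nd_p_min k L > 0"
    and P: "P > 0" and k: "k \<ge> 1"
  shows "finite (code k L P R xR)"
proof (rule finite_shifted_lattice_bounded[OF L vol Nd P k])
  show "code k L P R xR \<subseteq> shifted_lattice k L P R xR" by (auto simp: code_def)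
  fix x i assume "x \<in> code k L P R xR" "i < k"
  then show "cmod (x i) \<le> sqrt ((sqrt (P * real k))\<^sup>2)"
    using P by (intro cmod_le_of_sum_square_le[where k=k]) (auto simp: code_def closed_ball_iff)
qed

text \<open>The ball of squared radius \<open>P * real k\<close> has volume
  \<open>C1 k * P ^ k\<close>; the scaling is made so that the scaled lattice has exactly this
  volume divided by \<open>2 powr (R * real k)\<close>.\<close>

lemma scaling_power:
  assumes P: "P > 0" and vol: "lattice_vol k L > 0" and k: "k \<ge> 1"
  shows "((scaling k L P R)\<^sup>2) ^ k = C1 k * P ^ k / (2 powr (R * real k) * lattice_vol k L)"
proof -
  have "((scaling k L P R)\<^sup>2) ^ k = ((scaling k L P R)\<^sup>2) powr real k"
    using scaling_pos[OF P vol k, of R] by (simp add: powr_realpow)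
  also have "\<dots> = (C1 k powr (1 / real k) * P) powr real k / ((2 powr R * lattice_vol k L powr (1 / real k)) powr real k)"
    unfolding scaling_square[OF P vol] by (rule powr_divide)
  also have "(C1 k powr (1 / real k) * P) powr real k = C1 k * P ^ k"
    using P k C1_pos[OF k] by (simp add: powr_mult powr_powr powr_realpow)
  also have "(2 powr R * lattice_vol k L powr (1 / real k)) powr real k = 2 powr (R * real k) * lattice_vol k L"
    using vol k by (simp add: powr_mult powr_powr)
  finally show ?thesis .
qed

text \<open>The scaling is divided out: the lattice stays as it is and the ball shrinks until its
  volume is \<open>2 powr (R * real k)\<close> times that of a cell, so that averaging applies. The
  translate found is then multiplied by the scaling.\<close>

lemma exists_admissible_shift:
  assumes L: "full_lattice k L" and vol: "lattice_vol k L > 0" and Nd: "Nd_p_min k L > 0"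
    and P: "P > 0" and k: "k \<ge> 1"
  obtains xR where "admissible_shift k L P R xR"
proof -
  define b where "b = (SOME b. lattice_basis k L b)"
  have b: "lattice_basis k L b" using L unfolding full_lattice_def b_def by (rule someI_ex)
  have V: "lattice_vol k L = measure (cmeasure k) (parallelotope k b)"
    by (simp add: lattice_vol_def b_def)
  define \<alpha> where "\<alpha> = scaling k L P R"
  have \<alpha>: "\<alpha> > 0" using scaling_pos[OF P vol k] by (simp add: \<alpha>_def)
  define t where "t = P * real k / \<alpha>\<^sup>2"
  have t: "t \<ge> 0" using P by (simp add: t_def)
  define B where "B = {x \<in> cspace k. (\<Sum>i<k. (cmod (x i))\<^sup>2) \<le> t}"
  have "(pi * t) ^ k / fact k = C1 k * P ^ k / ((\<alpha>\<^sup>2) ^ k)"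
    by (simp add: t_def C1_def power_divide power_mult_distrib mult_ac)
  also have "\<dots> = 2 powr (R * real k) * lattice_vol k L"
    using scaling_power[OF P vol k, of R] vol P C1_pos[OF k] by (simp add: \<alpha>_def)
  finally have volB: "emeasure (cmeasure k) B = ennreal (2 powr (R * real k) * lattice_vol k L)"
    unfolding B_def emeasure_cmeasure_ball[OF t] by simp
  have fin: "finite {v \<in> L. (\<lambda>i\<in>{..<k}. x i + v i) \<in> B}" if "x \<in> cspace k" for x
  proof (rule finite_product_separated[OF k])
    show "{v \<in> L. (\<lambda>i\<in>{..<k}. x i + v i) \<in> B} \<subseteq> cspace k"
      using lattice_subset_cspace[OF L] by auto
    show "0 < Nd_p_min k L * sqrt (lattice_vol k L)" using Nd vol by simp
    fix v i assume v: "v \<in> {v \<in> L. (\<lambda>i\<in>{..<k}. x i + v i) \<in> B}" and i: "i < k"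
    have "cmod ((\<lambda>i\<in>{..<k}. x i + v i) i) \<le> sqrt t"
      using v i by (intro cmod_le_of_sum_square_le[where k=k]) (auto simp: B_def)
    then have "cmod (x i + v i) \<le> sqrt t" using i by simp
    moreover have "cmod (v i) \<le> cmod (x i + v i) + cmod (x i)"
      using norm_triangle_ineq4[of "x i + v i" "x i"] by simp
    \<comment> \<open>Summing over all coordinates gives one radius valid for every
      \<open>i\<close>.\<close>
    moreover have "cmod (x i) \<le> (\<Sum>i<k. cmod (x i))" using i by (intro member_le_sum) auto
    ultimately show "cmod (v i) \<le> sqrt t + (\<Sum>i<k. cmod (x i))" by linarith
  qed (use lattice_prod_diff_ge[OF L vol] in auto)
  obtain x where x: "x \<in> cspace k" "real (card {v \<in> L. (\<lambda>i\<in>{..<k}. x i + v i) \<in> B}) \<ge> 2 powr (R * real k)"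
  proof (rule exists_translate_card_ge[OF b, of B "2 powr (R * real k)"])
    show "0 < measure (cmeasure k) (parallelotope k b)" using vol V by simp
    show "B \<in> sets (cmeasure k)" unfolding B_def by (rule sets_sum_cmod_le)
    show "ennreal (2 powr (R * real k) * measure (cmeasure k) (parallelotope k b)) \<le> emeasure (cmeasure k) B"
      using volB V by simp
  qed (use fin in auto)
  define xR where "xR = (\<lambda>i\<in>{..<k}. complex_of_real \<alpha> * x i)"
  let ?s = "\<lambda>v. \<lambda>i\<in>{..<k}. xR i + complex_of_real \<alpha> * v i"
  have "?s v \<in> closed_ball k (sqrt (P * real k)) \<longleftrightarrow> (\<lambda>i\<in>{..<k}. x i + v i) \<in> B" for v
  proof -
    have "(\<Sum>i<k. (cmod (?s v i))\<^sup>2) = \<alpha>\<^sup>2 * (\<Sum>i<k. (cmod ((\<lambda>i\<in>{..<k}. x i + v i) i))\<^sup>2)"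
    proof -
      have "cmod (?s v i) = \<alpha> * cmod (x i + v i)" if "i < k" for i
      proof -
        have "?s v i = complex_of_real \<alpha> * (x i + v i)"
          using that by (simp add: xR_def algebra_simps)
        then show ?thesis using \<alpha> by (simp add: norm_mult)
      qed
      then show ?thesis by (simp add: sum_distrib_left power_mult_distrib)
    qed
    moreover have "?s v \<in> cspace k" "(\<lambda>i\<in>{..<k}. x i + v i) \<in> cspace k" by (auto simp: cspace_def)
    ultimately show ?thesis
      using \<alpha> P by (simp add: closed_ball_iff B_def t_def field_simps)
  qed
  then have "code k L P R xR = ?s ` {v \<in> L. (\<lambda>i\<in>{..<k}. x i + v i) \<in> B}"
    unfolding code_def shifted_lattice_def \<alpha>_def[symmetric] by auto
  moreover have "inj_on ?s {v \<in> L. (\<lambda>i\<in>{..<k}. x i + v i) \<in> B}"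
  proof (rule inj_onI)
    fix u v assume uv: "u \<in> {v \<in> L. (\<lambda>i\<in>{..<k}. x i + v i) \<in> B}" "v \<in> {v \<in> L. (\<lambda>i\<in>{..<k}. x i + v i) \<in> B}" "?s u = ?s v"
    show "u = v"
    proof
      fix i
      show "u i = v i"
      proof (cases "i < k")
        case True
        then show ?thesis using fun_cong[OF uv(3), of i] \<alpha> by simp
      next
        case False
        have "u \<in> cspace k" "v \<in> cspace k" using uv lattice_subset_cspace[OF L] by auto
        then show ?thesis using False by (auto simp: cspace_def PiE_def extensional_def)
      qed
    qed
  qed
  ultimately have "card (code k L P R xR) = card {v \<in> L. (\<lambda>i\<in>{..<k}. x i + v i) \<in> B}"
    by (simp add: card_image)
  then have "admissible_shift k L P R xR"
    using x by (auto simp: admissible_shift_def xR_def cspace_def)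
  then show thesis by (rule that)
qed

section \<open>Decoding\<close>

text \<open>Enumerating the search set and taking the first minimizer breaks ties measurably,
  because the least index satisfying countably many measurable conditions is measurable.\<close>

lemma exists_min_dist_decoder:
  assumes S: "countable S" "S \<noteq> {}"
  obtains D where "min_dist_decoder k S D"
proof -
  let ?B = "\<Pi>\<^sub>M i\<in>{..<k}. (borel :: complex measure)"
  define s where "s = from_nat_into S"
  have ran: "range s = S" using S by (simp add: s_def range_from_nat_into)
  \<comment> \<open>If no minimizer exists, the implication makes \<open>Q\<close> true for every
    index, so \<open>LEAST\<close> is always well defined and the decoder returns
    \<open>s 0\<close>.\<close>
  define Q where "Q = (\<lambda>(h, y) n. (\<exists>n. \<forall>m. sq_dist k h y (s n) \<le> sq_dist k h y (s m)) \<longrightarrow>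
                          (\<forall>m. sq_dist k h y (s n) \<le> sq_dist k h y (s m)))"
  define D where "D = (\<lambda>h y. s (LEAST n. Q (h, y) n))"
  have ex: "\<exists>n. Q p n" for p
    unfolding Q_def by (auto split: prod.splits)
  have meas_dist: "(\<lambda>p. sq_dist k (fst p) (snd p) x) \<in> borel_measurable (?B \<Otimes>\<^sub>M ?B)" for x
    unfolding sq_dist_def by measurable
  have "(\<lambda>p. Q p n) \<in> measurable (?B \<Otimes>\<^sub>M ?B) (count_space UNIV)" for n
  proof -
    note [measurable] = meas_dist
    show ?thesis unfolding Q_def case_prod_beta by measurable
  qed
  then have "(\<lambda>p. LEAST n. Q p n) \<in> measurable (?B \<Otimes>\<^sub>M ?B) (count_space UNIV)"
    by (rule measurable_Least)
  moreover have "s \<in> count_space UNIV \<rightarrow>\<^sub>M count_space S"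
    using ran by auto
  ultimately have "(\<lambda>p. s (LEAST n. Q p n)) \<in> (?B \<Otimes>\<^sub>M ?B) \<rightarrow>\<^sub>M count_space S"
    by (rule measurable_compose)
  then have 1: "(\<lambda>(h, y). D h y) \<in> (?B \<Otimes>\<^sub>M ?B) \<rightarrow>\<^sub>M count_space S"
    by (simp add: D_def case_prod_beta')
  have 2: "is_arg_min (sq_dist k h y) (\<lambda>x'. x' \<in> S) (D h y)"
    if "is_arg_min (sq_dist k h y) (\<lambda>x'. x' \<in> S) x" for h y x
  proof -
    have "x \<in> S" using that by (simp add: is_arg_min_def)
    then obtain n where n: "x = s n" using ran by auto
    have "\<forall>m. sq_dist k h y (s n) \<le> sq_dist k h y (s m)"
      using that ran unfolding is_arg_min_def n by (metis not_le rangeI)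
    then have "Q (h, y) j \<Longrightarrow> \<forall>m. sq_dist k h y (s j) \<le> sq_dist k h y (s m)" for j
      unfolding Q_def by auto
    from this[OF LeastI_ex[OF ex]] have "\<forall>m. sq_dist k h y (D h y) \<le> sq_dist k h y (s m)"
      unfolding D_def .
    moreover have "D h y \<in> S" using ran by (auto simp: D_def)
    ultimately show ?thesis using ran unfolding is_arg_min_def by (metis not_le rangeE)
  qed
  have "min_dist_decoder k S D"
    unfolding min_dist_decoder_def using 1 2 by blast
  then show thesis by (rule that)
qed

text \<open>The search set may be infinite, but only points at least as close as \<open>x0\<close>
  compete, and the nonzero coefficients confine these to a bounded set.\<close>

lemma exists_min_dist:
  assumes L: "full_lattice k L" and vol: "lattice_vol k L > 0" and Nd: "Nd_p_min k L > 0"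
    and P: "P > 0" and k: "k \<ge> 1"
    and S: "S \<subseteq> shifted_lattice k L P R xR" "x0 \<in> S"
    and h: "\<And>i. i < k \<Longrightarrow> h i \<noteq> 0"
  obtains x where "is_arg_min (sq_dist k h y) (\<lambda>x'. x' \<in> S) x"
proof -
  define X where "X = {x \<in> S. sq_dist k h y x \<le> sq_dist k h y x0}"
  let ?t = "sq_dist k h y x0"
  have "finite X"
  proof (rule finite_shifted_lattice_bounded[OF L vol Nd P k])
    show "X \<subseteq> shifted_lattice k L P R xR" using S by (auto simp: X_def)
    fix x i assume x: "x \<in> X" and i: "i < k"
    have "cmod (y i - h i * x i) \<le> sqrt ?t"
      using x i by (intro cmod_le_of_sum_square_le[where k=k and x="\<lambda>i. y i - h i * x i"]) (auto simp: X_def sq_dist_def)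
    moreover have "cmod (h i * x i) \<le> cmod (y i - h i * x i) + cmod (y i)"
      using norm_triangle_ineq4[of "y i" "y i - h i * x i"] by simp
    ultimately have "cmod (h i) * cmod (x i) \<le> sqrt ?t + cmod (y i)"
      by (simp add: norm_mult)
    then have "cmod (x i) \<le> (sqrt ?t + cmod (y i)) / cmod (h i)"
      using h[OF i] by (simp add: field_simps)
    also have "\<dots> \<le> (\<Sum>i<k. (sqrt ?t + cmod (y i)) / cmod (h i))"
      using i by (intro member_le_sum) (auto intro!: divide_nonneg_nonneg add_nonneg_nonneg simp: sq_dist_def sum_nonneg)
    finally show "cmod (x i) \<le> (\<Sum>i<k. (sqrt ?t + cmod (y i)) / cmod (h i))" .
  qed
  moreover have "x0 \<in> X" using S by (simp add: X_def)
  ultimately obtain x where x: "x \<in> X" "\<And>x'. x' \<in> X \<Longrightarrow> sq_dist k h y x \<le> sq_dist k h y x'"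
    by (metis arg_min_if_finite(1) arg_min_least empty_iff)
  have "is_arg_min (sq_dist k h y) (\<lambda>x'. x' \<in> S) x"
    unfolding is_arg_min_def
  proof (intro conjI notI)
    show "x \<in> S" using x by (simp add: X_def)
    assume "\<exists>z. z \<in> S \<and> sq_dist k h y z < sq_dist k h y x"
    then obtain z where z: "z \<in> S" "sq_dist k h y z < sq_dist k h y x" by blast
    have "z \<in> X" using z x(2)[OF \<open>x0 \<in> X\<close>] x(1) by (auto simp: X_def)
    then show False using x(2) z by force
  qed
  then show thesis by (rule that)
qed

text \<open>The volume cancels between the scaling and the normalization in \<open>Nd_p_min\<close>,
  so the lattice enters the threshold only through the quantity that the main theorem bounds below
  by \<open>c\<close>.\<close>

lemma scaled_distance_powr:
  assumes P: "P > 0" and vol: "lattice_vol k L > 0" and Nd: "Nd_p_min k L > 0" and k: "k \<ge> 1"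
  shows "((scaling k L P R ^ k * (Nd_p_min k L * sqrt (lattice_vol k L)))\<^sup>2) powr (1 / real k) =
         C1 k powr (1 / real k) * P / 2 powr R * Nd_p_min k L powr (2 / real k)"
proof -
  have sq: "(scaling k L P R ^ k * (Nd_p_min k L * sqrt (lattice_vol k L)))\<^sup>2 =
      ((scaling k L P R)\<^sup>2) ^ k * (Nd_p_min k L)\<^sup>2 * lattice_vol k L"
    using vol by (simp add: power_mult_distrib power2_eq_square)
  have "(Nd_p_min k L powr 2) powr (1 / real k) = Nd_p_min k L powr (2 / real k)"
    unfolding powr_powr by simp
  then have Nd2: "(Nd_p_min k L)\<^sup>2 powr (1 / real k) = Nd_p_min k L powr (2 / real k)"
    using Nd by simp
  note sq
  also have "((scaling k L P R)\<^sup>2) ^ k * (Nd_p_min k L)\<^sup>2 * lattice_vol k L = C1 k * P ^ k / 2 powr (R * real k) * (Nd_p_min k L)\<^sup>2"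
    unfolding scaling_power[OF P vol k] using vol by simp
  also have "\<dots> = C1 k * P powr real k / 2 powr (R * real k) * (Nd_p_min k L)\<^sup>2"
    using P by (simp add: powr_realpow)
  also have "\<dots> powr (1 / real k) = C1 k powr (1 / real k) * P / 2 powr R * Nd_p_min k L powr (2 / real k)"
    using P k C1_pos[OF k] Nd2 by (simp add: powr_mult powr_divide powr_powr)
  finally show ?thesis .
qed

text \<open>Relative to \<open>x\<close> the residual is the noise, relative to \<open>y\<close> the
  noise minus the faded difference. The factor 4, and with it the 4 in the rate, comes from (a +
  b)^2 \<le> 2 a^2 + 2 b^2 in each coordinate, the second residual being no larger in total than the
  first. The non-strict \<open>closer\<close> covers every way of breaking ties.\<close>

lemma noise_ge_of_decoding_error:
  assumes L: "full_lattice k L" and vol: "lattice_vol k L > 0" and Nd: "Nd_p_min k L > 0"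
    and P: "P > 0" and k: "k \<ge> 1"
    and xy: "x \<in> shifted_lattice k L P R xR" "y \<in> shifted_lattice k L P R xR" "x \<noteq> y"
    and h: "\<And>i. i < k \<Longrightarrow> h i \<noteq> 0"
    and closer: "sq_dist k h (received k h x w) y \<le> sq_dist k h (received k h x w) x"
  shows "real k * (2 powr ((\<Sum>i<k. log 2 ((cmod (h i))\<^sup>2)) / real k) *
           (C1 k powr (1 / real k) * P / 2 powr R * Nd_p_min k L powr (2 / real k)))
         \<le> 4 * (\<Sum>i<k. (cmod (w i))\<^sup>2)"
proof -
  let ?z = "\<lambda>i. y i - x i"
  let ?d = "scaling k L P R ^ k * (Nd_p_min k L * sqrt (lattice_vol k L))"
  have d: "?d > 0" using scaling_pos[OF P vol k] Nd vol by simp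
  have "(\<Prod>i<k. (cmod (h i))\<^sup>2) = 2 powr (\<Sum>i<k. log 2 ((cmod (h i))\<^sup>2))"
    using h by (simp add: powr_sum)
  then have H: "(\<Prod>i<k. (cmod (h i))\<^sup>2) powr (1 / real k) = 2 powr ((\<Sum>i<k. log 2 ((cmod (h i))\<^sup>2)) / real k)"
    by (simp add: powr_powr)
  have sq_x: "sq_dist k h (received k h x w) x = (\<Sum>i<k. (cmod (w i))\<^sup>2)"
    by (simp add: sq_dist_def received_def)
  have sq_y: "sq_dist k h (received k h x w) y = (\<Sum>i<k. (cmod (w i - h i * ?z i))\<^sup>2)"
    unfolding sq_dist_def received_def by (intro sum.cong) (auto simp: algebra_simps)
  have "(\<Prod>i<k. (cmod (h i))\<^sup>2) * ?d\<^sup>2 \<le> (\<Prod>i<k. (cmod (h i))\<^sup>2) * (\<Prod>i<k. cmod (?z i))\<^sup>2"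
    using shifted_lattice_prod_diff_ge[OF L vol P k xy(2,1)] xy(3) d
    by (intro mult_left_mono power_mono prod_nonneg) auto
  also have "\<dots> = (\<Prod>i<k. (cmod (h i * ?z i))\<^sup>2)"
    by (simp add: norm_mult power_mult_distrib prod.distrib prod_power_distrib)
  finally have "((\<Prod>i<k. (cmod (h i))\<^sup>2) * ?d\<^sup>2) powr (1 / real k) \<le> (\<Prod>i<k. (cmod (h i * ?z i))\<^sup>2) powr (1 / real k)"
    by (intro powr_mono2 mult_nonneg_nonneg prod_nonneg) auto
  also have "\<dots> \<le> (\<Sum>i<k. (cmod (h i * ?z i))\<^sup>2 / real k)"
    using arith_geom_mean[of "{..<k}" "\<lambda>i. (cmod (h i * ?z i))\<^sup>2"] k by (auto simp: lessThan_empty_iff)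
  also have "\<dots> = (\<Sum>i<k. (cmod (h i * ?z i))\<^sup>2) / real k" by (simp add: sum_divide_distrib)
  also have "((\<Prod>i<k. (cmod (h i))\<^sup>2) * ?d\<^sup>2) powr (1 / real k) =
      (\<Prod>i<k. (cmod (h i))\<^sup>2) powr (1 / real k) * (?d\<^sup>2) powr (1 / real k)"
    by (rule powr_mult)
  finally have "real k * ((\<Prod>i<k. (cmod (h i))\<^sup>2) powr (1 / real k) * (?d\<^sup>2) powr (1 / real k)) \<le> (\<Sum>i<k. (cmod (h i * ?z i))\<^sup>2)"
    using k by (simp add: field_simps)
  also have "\<dots> \<le> (\<Sum>i<k. 2 * (cmod (w i))\<^sup>2 + 2 * (cmod (w i - h i * ?z i))\<^sup>2)"
  proof (rule sum_mono)
    fix i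
    let ?a = "cmod (w i)" and ?b = "cmod (w i - h i * ?z i)"
    have "cmod (h i * ?z i) \<le> ?a + ?b"
      using norm_triangle_ineq4[of "w i" "w i - h i * ?z i"] by simp
    then have "(cmod (h i * ?z i))\<^sup>2 \<le> (?a + ?b)\<^sup>2" by (intro power_mono) auto
    also have "\<dots> \<le> 2 * ?a\<^sup>2 + 2 * ?b\<^sup>2"
      using zero_le_power2[of "?a - ?b"] by (simp add: power2_eq_square algebra_simps)
    finally show "(cmod (h i * ?z i))\<^sup>2 \<le> 2 * ?a\<^sup>2 + 2 * ?b\<^sup>2" .
  qed
  also have "\<dots> \<le> 4 * (\<Sum>i<k. (cmod (w i))\<^sup>2)"
    using closer unfolding sq_x sq_y by (simp add: sum.distrib sum_distrib_left[symmetric])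
  finally show ?thesis unfolding H scaled_distance_powr[OF P vol Nd k] .
qed

section \<open>Noise energy and the asymptotics of the ball volume\<close>

lemma cgaussian_density_eq: "cgaussian_density z = exp (- (cmod z)\<^sup>2) / pi"
proof -
  have "sqrt pi * sqrt pi = pi" by simp
  then show ?thesis
    by (simp add: cgaussian_density_def normal_density_def cmod_power2 mult_exp_exp real_sqrt_mult[symmetric])
qed

text \<open>The density pi of the squared modulus cancels the 1/pi of the Gaussian and leaves exp
  (-s) on the half-line.\<close>

lemma (in prob_space) cgaussian_square_exponential:
  assumes w: "distributed M lborel w (\<lambda>z. ennreal (cgaussian_density z))"
  shows "distributed M lborel (\<lambda>\<omega>. (cmod (w \<omega>))\<^sup>2) (exponential_density 1)"
proof (rule exponential_distributedI)
  have [measurable]: "w \<in> borel_measurable M" using distributed_measurable[OF w] by simp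
  show "(\<lambda>\<omega>. (cmod (w \<omega>))\<^sup>2) \<in> borel_measurable M" by measurable
  fix a :: real assume a: "0 \<le> a"
  have "{\<omega> \<in> space M. (cmod (w \<omega>))\<^sup>2 \<le> a} = w -` {z. (cmod z)\<^sup>2 \<le> a} \<inter> space M" by auto
  moreover have "{z::complex. (cmod z)\<^sup>2 \<le> a} \<in> sets lborel" by measurable
  ultimately have "emeasure M {\<omega> \<in> space M. (cmod (w \<omega>))\<^sup>2 \<le> a} =
      (\<integral>\<^sup>+ z. ennreal (cgaussian_density z) * indicator {z. (cmod z)\<^sup>2 \<le> a} z \<partial>lborel)"
    by (simp only: distributed_emeasure[OF w])
  also have "\<dots> = (\<integral>\<^sup>+ z. ennreal (exp (- (cmod z)\<^sup>2) / pi) * indicator {..a} ((cmod z)\<^sup>2) \<partial>lborel)"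
    by (intro nn_integral_cong) (auto simp: cgaussian_density_eq indicator_def)
  also have "\<dots> = (\<integral>\<^sup>+ s. ennreal (pi * indicator {0..} s) * (ennreal (exp (- s) / pi) * indicator {..a} s) \<partial>lborel)"
    by (subst nn_integral_cmod_square[symmetric]) auto
  also have "\<dots> = (\<integral>\<^sup>+ s. ennreal (exp (- s)) * indicator {0..a} s \<partial>lborel)"
    by (intro nn_integral_cong) (auto simp: indicator_def ennreal_mult'[symmetric])
  also have "\<dots> = ennreal (- exp (- a) - (- exp (- 0)))"
    by (rule nn_integral_FTC_Icc) (use a in \<open>auto intro!: derivative_eq_intros\<close>)
  finally show "emeasure M {\<omega> \<in> space M. (cmod (w \<omega>))\<^sup>2 \<le> a} = 1 - ennreal (exp (- a * 1))"
    by (simp add: ennreal_minus flip: ennreal_1)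
qed simp

text \<open>A sum of \<open>k\<close> independent unit exponentials is Erlang with mean and variance
  \<open>k\<close>, so Chebyshev already gives decay of order 1/k for a fixed relative excess
  \<open>\<delta>\<close>.\<close>

lemma (in prob_space) cgaussian_energy_tail:
  assumes w: "\<And>i. distributed M lborel (w i) (\<lambda>z. ennreal (cgaussian_density z))"
    and ind: "indep_vars (\<lambda>_. borel) w UNIV"
    and k: "k \<ge> 1" and \<delta>: "\<delta> > 0"
  shows "prob {\<omega> \<in> space M. (\<Sum>i<k. (cmod (w i \<omega>))\<^sup>2) \<ge> real k * (1 + \<delta>)} \<le> 1 / (real k * \<delta>\<^sup>2)"
proof -
  define X where "X = (\<lambda>\<omega>. \<Sum>i<k. (cmod (w i \<omega>))\<^sup>2)"
  have "indep_vars (\<lambda>_. borel) (\<lambda>i \<omega>. (cmod (w i \<omega>))\<^sup>2) {..<k}"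
    by (rule indep_vars_compose2[OF indep_vars_subset[OF ind]]) auto
  \<comment> \<open>\<open>erlang_density\<close> counts its shape from 0, so \<open>k\<close>
    summands correspond to \<open>k - 1\<close>.\<close>
  then have X: "distributed M lborel X (erlang_density (k - 1) 1)"
    using exponential_distributed_sum[of "{..<k}" 1 "\<lambda>i \<omega>. (cmod (w i \<omega>))\<^sup>2"] k
      cgaussian_square_exponential[OF w] unfolding X_def by (auto simp: lessThan_empty_iff)
  have [measurable]: "X \<in> borel_measurable M" using distributed_measurable[OF X] by simp
  have EX: "expectation X = real k"
    using erlang_ith_moment[of 1 X "k - 1" 1] X k fact_reduce[of k, where 'a=real] by simp
  have VX: "variance X = real k"
    using erlang_distributed_variance[of 1 X "k - 1"] X k by simp
  have "prob {\<omega> \<in> space M. X \<omega> \<ge> real k * (1 + \<delta>)} \<le> prob {\<omega> \<in> space M. \<bar>X \<omega> - expectation X\<bar> \<ge> real k * \<delta>}"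
    unfolding EX by (intro finite_measure_mono) (auto simp: algebra_simps)
  also have "\<dots> \<le> variance X / (real k * \<delta>)\<^sup>2"
    using erlang_ith_moment_integrable[of 1 X "k - 1" 2] X k \<delta>
    by (intro Chebyshev_inequality) auto
  also have "\<dots> = 1 / (real k * \<delta>\<^sup>2)"
    unfolding VX using k by (simp add: power2_eq_square)
  finally show ?thesis by (simp add: X_def)
qed

section \<open>Growth of the ball volume\<close>

text \<open>Induction on the fact that (1 + 1/n)^(n+1) is at least e. The loss
  \<open>exp 1 * real n\<close> against the true exponential rate is harmless, as its
  \<open>n\<close>-th root tends to 1.\<close>

lemma fact_le_Stirling:
  assumes "n \<ge> 1"
  shows "fact n \<le> exp 1 * real n * (real n / exp 1) ^ n"
  using assms
proof (induction n rule: nat_induct_at_least)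
  case (Suc n)
  let ?x = "1 + 1 / real n"
  have n: "real n > 0" using Suc.hyps by simp
  \<comment> \<open>The bound ln (1 + x) \<ge> x / (1 + x) at x = 1/n, multiplied by n + 1, has left
    side exactly 1.\<close>
  have "1 = (1 + real n) * ((1 / real n) / ?x)" using n by (simp add: field_simps)
  also have "\<dots> \<le> (1 + real n) * ln ?x"
    using n ln_add1_ge[of "1 / real n"] by (intro mult_left_mono) (auto simp: add.commute)
  also have "\<dots> = ln (?x ^ Suc n)" using n by (simp add: ln_realpow add_pos_pos del: power_Suc)
  finally have "exp 1 \<le> exp (ln (?x ^ Suc n))" by (simp del: power_Suc)
  also have "\<dots> = ?x ^ Suc n" using n by (intro exp_ln zero_less_power) (simp add: add_pos_pos)
  finally have e: "exp 1 \<le> ?x ^ Suc n" .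
  have "fact (Suc n) = real (Suc n) * fact n" by simp
  also have "\<dots> \<le> real (Suc n) * (exp 1 * real n * (real n / exp 1) ^ n)"
    using Suc.IH by (intro mult_left_mono) auto
  also have "\<dots> = exp 1 * real (Suc n) * (real n / exp 1) ^ Suc n * exp 1"
    by (simp add: field_simps)
  also have "\<dots> \<le> exp 1 * real (Suc n) * (real n / exp 1) ^ Suc n * ?x ^ Suc n"
    using e n by (intro mult_left_mono) auto
  also have "\<dots> = exp 1 * real (Suc n) * ((real n / exp 1) * ?x) ^ Suc n"
    by (simp only: power_mult_distrib mult.assoc)
  also have "(real n / exp 1) * ?x = real (Suc n) / exp 1" using n by (simp add: field_simps)
  finally show ?case .
qed simp

text \<open>A lower bound is the useful direction: \<open>C1\<close> sets the spacing of the scaled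
  lattice, and a wider spacing makes errors rarer.\<close>

lemma C1_root_ge:
  assumes k: "k \<ge> 1"
  shows "C1 k powr (1 / real k) \<ge> pi * exp 1 / (exp 1 * real k) powr (1 / real k)"
proof -
  have kp: "real k > 0" using k by simp
  have "(pi * exp 1) ^ k / (exp 1 * real k) = (pi * real k) ^ k / (exp 1 * real k * (real k / exp 1) ^ k)"
    using kp by (simp add: power_mult_distrib power_divide)
  also have "\<dots> \<le> C1 k"
    unfolding C1_def using fact_le_Stirling[OF k] kp by (intro divide_left_mono) auto
  finally have "((pi * exp 1) ^ k / (exp 1 * real k)) powr (1 / real k) \<le> C1 k powr (1 / real k)"
    using kp by (intro powr_mono2) auto
  also have "((pi * exp 1) ^ k / (exp 1 * real k)) powr (1 / real k) = pi * exp 1 / (exp 1 * real k) powr (1 / real k)"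
    using kp by (simp add: powr_divide powr_realpow[symmetric] powr_powr)
  finally show ?thesis .
qed

lemma eventually_root_le:
  assumes "\<epsilon> > 0"
  shows "eventually (\<lambda>k. (exp 1 * real k) powr (1 / real k) \<le> 2 powr \<epsilon>) sequentially"
proof -
  have "(\<lambda>k. (exp 1 * real k) powr (1 / real k)) \<longlonglongrightarrow> 1"
    by real_asymp
  moreover have "(1::real) < 2 powr \<epsilon>" using assms by simp
  ultimately show ?thesis by (auto dest!: order_tendstoD(2) elim: eventually_mono)
qed

section \<open>Achievability\<close>

text \<open>\<open>E\<close> depends on the outcome alone, so the error set lies in the rectangle
  \<open>C \<times> (E \<union> N)\<close>, where \<open>N\<close> is the null set of vanishing
  coefficients, and the uniform measure of \<open>C\<close> contributes 1. The search set
  \<open>S\<close> may be anything between the code and the shifted lattice, which serves both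
  decoders.\<close>

lemma error_prob_le:
  fixes M :: "'a measure"
  assumes M: "prob_space M"
    and hm: "\<And>i. h i \<in> borel_measurable M" and h0: "\<And>i. AE \<omega> in M. h i \<omega> \<noteq> 0"
    and L: "full_lattice k L" and vol: "lattice_vol k L > 0" and Nd: "Nd_p_min k L > 0"
    and P: "P > 0" and k: "k \<ge> 1"
    and C: "finite C" "C \<noteq> {}" "C \<subseteq> S" and S: "S \<subseteq> shifted_lattice k L P R xR"
    and D: "min_dist_decoder k S D"
    and E: "E \<in> sets M"
      "\<And>\<omega>. \<omega> \<in> space M \<Longrightarrow>
        real k * (2 powr ((\<Sum>i<k. log 2 ((cmod (h i \<omega>))\<^sup>2)) / real k) *
           (C1 k powr (1 / real k) * P / 2 powr R * Nd_p_min k L powr (2 / real k)))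
         \<le> 4 * (\<Sum>i<k. (cmod (w i \<omega>))\<^sup>2) \<Longrightarrow> \<omega> \<in> E"
  shows "error_prob M h w k C D \<le> measure M E"
proof -
  interpret M: prob_space M by (rule M)
  note [measurable] = hm E(1)
  define N where "N = {\<omega> \<in> space M. \<exists>i<k. h i \<omega> = 0}"
  have Nm [measurable]: "N \<in> sets M" unfolding N_def by measurable
  have "AE \<omega> in M. \<forall>i<k. h i \<omega> \<noteq> 0" using h0 by (subst AE_all_countable) auto
  then have "AE \<omega> in M. \<omega> \<notin> N" by eventually_elim (auto simp: N_def)
  then have N0: "measure M N = 0" by (subst M.prob_eq_0) auto
  interpret U: prob_space "uniform_count_measure C"
    by (rule prob_space_uniform_count_measure) (use C in auto)
  interpret UM: pair_prob_space "uniform_count_measure C" M ..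
  let ?err = "{(x, \<omega>) \<in> C \<times> space M.
    D (\<lambda>i\<in>{..<k}. h i \<omega>) (received k (\<lambda>i. h i \<omega>) x (\<lambda>i. w i \<omega>)) \<noteq> x}"
  have sub: "?err \<subseteq> C \<times> (E \<union> N)"
  proof (intro subsetI, clarify)
    fix x \<omega> assume x: "x \<in> C" and \<omega>: "\<omega> \<in> space M" "\<omega> \<notin> N"
      and ne: "D (\<lambda>i\<in>{..<k}. h i \<omega>) (received k (\<lambda>i. h i \<omega>) x (\<lambda>i. w i \<omega>)) \<noteq> x"
    define g where "g = (\<lambda>i\<in>{..<k}. h i \<omega>)"
    define r where "r = received k (\<lambda>i. h i \<omega>) x (\<lambda>i. w i \<omega>)"
    have r: "r = received k g x (\<lambda>i. w i \<omega>)"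
      unfolding r_def received_def g_def by (intro restrict_ext) simp
    have g: "g i \<noteq> 0" if "i < k" for i using that \<omega> by (auto simp: g_def N_def)
    have gr: "g \<in> cspace k" "r \<in> cspace k" by (auto simp: g_def r_def received_def cspace_def)
    have xS: "x \<in> S" using x C by auto
    obtain z where z: "is_arg_min (sq_dist k g r) (\<lambda>x'. x' \<in> S) z"
      using exists_min_dist[OF L vol Nd P k S xS, of g r] g by blast
    have D_min: "is_arg_min (sq_dist k g r) (\<lambda>x'. x' \<in> S) (D g r)"
      using D gr z unfolding min_dist_decoder_def by blast
    then have "D g r \<in> S" "sq_dist k g r (D g r) \<le> sq_dist k g r x"
      using xS by (auto simp: is_arg_min_def not_less)
    then have "real k * (2 powr ((\<Sum>i<k. log 2 ((cmod (g i))\<^sup>2)) / real k) *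
           (C1 k powr (1 / real k) * P / 2 powr R * Nd_p_min k L powr (2 / real k)))
         \<le> 4 * (\<Sum>i<k. (cmod (w i \<omega>))\<^sup>2)"
      using S xS ne g unfolding r_def[symmetric] g_def[symmetric]
      by (intro noise_ge_of_decoding_error[OF L vol Nd P k, of x R xR "D g r"]) (auto simp: r)
    also have "(\<Sum>i<k. log 2 ((cmod (g i))\<^sup>2)) = (\<Sum>i<k. log 2 ((cmod (h i \<omega>))\<^sup>2))"
      by (intro sum.cong) (auto simp: g_def)
    finally show "\<omega> \<in> E" by (rule E(2)[OF \<omega>(1)])
  qed
  have "error_prob M h w k C D \<le> measure (uniform_count_measure C \<Otimes>\<^sub>M M) (C \<times> (E \<union> N))"
    unfolding error_prob_def by (rule UM.finite_measure_mono[OF sub]) (auto simp: sets_uniform_count_measure)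
  also have "\<dots> = measure (uniform_count_measure C) C * measure M (E \<union> N)"
    by (simp add: measure_def M.emeasure_pair_measure_Times enn2real_mult sets_uniform_count_measure)
  also have "measure (uniform_count_measure C) C = 1"
    using U.prob_space by (simp add: space_uniform_count_measure)
  also have "measure M (E \<union> N) \<le> measure M E + measure M N"
    by (intro measure_Un_le) auto
  finally show ?thesis using N0 by simp
qed

theorem mainTheorem12:
  fixes M :: "'a measure"
    and h w :: "nat \<Rightarrow> 'a \<Rightarrow> complex"
    and H :: "'a \<Rightarrow> complex"
    and K :: "nat set"
    and L :: "nat \<Rightarrow> cvec set"
    and c P R :: real
  assumes "prob_space M"
    and "\<And>i. h i \<in> borel_measurable M"
    and "\<And>i. AE \<omega> in M. h i \<omega> \<noteq> 0"
    and "H \<in> borel_measurable M"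
    and "AE \<omega> in M. H \<omega> \<noteq> 0"
    and "integrable M (\<lambda>\<omega>. log 2 ((cmod (H \<omega>))\<^sup>2))"
    and "converges_in_prob M (\<lambda>k \<omega>. (\<Sum>i<k. log 2 ((cmod (h i \<omega>))\<^sup>2)) / real k)
           (LINT \<omega>|M. log 2 ((cmod (H \<omega>))\<^sup>2))"
    and "\<And>i. distributed M lborel (w i) (\<lambda>z. ennreal (cgaussian_density z))"
    and "prob_space.indep_vars M (\<lambda>_. borel) w UNIV"
    and "prob_space.indep_var M
           (\<Pi>\<^sub>M i\<in>UNIV. borel) (\<lambda>\<omega> i. h i \<omega>) (\<Pi>\<^sub>M i\<in>UNIV. borel) (\<lambda>\<omega> i. w i \<omega>)"
    and "infinite K" and "\<And>k. k \<in> K \<Longrightarrow> k \<ge> 1"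
    and "\<And>k. k \<in> K \<Longrightarrow> full_lattice k (L k)"
    and "c > 0"
    and "\<And>k. k \<in> K \<Longrightarrow> Nd_p_min k (L k) powr (2 / real k) \<ge> c"
    and "P > 0"
    and "R < (LINT \<omega>|M. log 2 (P * (cmod (H \<omega>))\<^sup>2)) + log 2 (pi * exp 1 / 4) + log 2 c"
  shows "achievable M h w K L P max_likelihood_decoder R \<and>
         achievable M h w K L P naive_lattice_decoder R"
proof -
  interpret M: prob_space M by fact
  note [measurable] = assms(2)
  have [measurable]: "w i \<in> borel_measurable M" for i
    using distributed_measurable[OF assms(8)[of i]] by simp
  note L = assms(13) and k1 = assms(12) and P = \<open>P > 0\<close> and c = \<open>c > 0\<close>
  have Nd: "Nd_p_min k (L k) > 0" if "k \<in> K" for k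
  proof -
    \<comment> \<open>\<open>0 powr a\<close> is 0, which is below \<open>c\<close>.\<close>
    have "Nd_p_min k (L k) \<noteq> 0" using assms(15)[OF that] c by auto
    then show ?thesis using Nd_p_min_nonneg[OF L k1] that by force
  qed
  have vol: "lattice_vol k (L k) > 0" if "k \<in> K" for k
    using lattice_vol_pos[OF L k1 Nd] that by blast
  define l where "l = (LINT \<omega>|M. log 2 ((cmod (H \<omega>))\<^sup>2))"
  have "(LINT \<omega>|M. log 2 (P * (cmod (H \<omega>))\<^sup>2)) = (LINT \<omega>|M. log 2 P + log 2 ((cmod (H \<omega>))\<^sup>2))"
  proof (rule integral_cong_AE)
    show "AE \<omega> in M. log 2 (P * (cmod (H \<omega>))\<^sup>2) = log 2 P + log 2 ((cmod (H \<omega>))\<^sup>2)"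
      using assms(5) by eventually_elim (use P in \<open>simp add: log_mult\<close>)
  qed (use assms(4) in measurable)
  also have "\<dots> = log 2 P + l"
    using assms(6) by (simp add: l_def M.prob_space)
  finally have rate: "R < log 2 P + l + log 2 (pi * exp 1 / 4) + log 2 c"
    using assms(17) by simp
  \<comment> \<open>One third of the rate gap each for the deviation of the fading mean, the loss in
    the root of \<open>C1 k\<close>, and the excess noise energy.\<close>
  define g where "g = (log 2 P + l + log 2 (pi * exp 1 / 4) + log 2 c - R) / 3"
  have g: "g > 0" using rate by (simp add: g_def)
  have gap: "2 powr (3 * g) = P * 2 powr l * (pi * exp 1 / 4) * c / 2 powr R"
  proof -
    have "3 * g = log 2 P + l + log 2 (pi * exp 1 / 4) + log 2 c - R" by (simp add: g_def)
    then have "2 powr (3 * g) = 2 powr log 2 P * 2 powr l * 2 powr log 2 (pi * exp 1 / 4) * 2 powr log 2 c / 2 powr R"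
      by (simp only: powr_add powr_diff)
    then show ?thesis using P c by (simp del: log_exp)
  qed
  define S where "S = (\<lambda>k \<omega>. (\<Sum>i<k. log 2 ((cmod (h i \<omega>))\<^sup>2)) / real k)"
  \<comment> \<open>Makes \<open>1 + \<delta>\<close> equal to \<open>2 powr g\<close>, the share
    reserved for the noise.\<close>
  define \<delta> where "\<delta> = 2 powr g - 1"
  have \<delta>: "\<delta> > 0" using g by (simp add: \<delta>_def)
  define E1 where "E1 = (\<lambda>k. {\<omega> \<in> space M. \<bar>S k \<omega> - l\<bar> > g})"
  define E2 where "E2 = (\<lambda>k. {\<omega> \<in> space M. (\<Sum>i<k. (cmod (w i \<omega>))\<^sup>2) \<ge> real k * (1 + \<delta>)})"
  have [measurable]: "E1 k \<in> sets M" "E2 k \<in> sets M" for k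
    unfolding E1_def E2_def S_def by measurable
  have E1_lim: "(\<lambda>k. measure M (E1 k)) \<longlonglongrightarrow> 0"
    using assms(7) g unfolding converges_in_prob_def E1_def S_def l_def by blast
  have E_lim: "(\<lambda>k. measure M (E1 k) + 1 / (real k * \<delta>\<^sup>2)) \<longlonglongrightarrow> 0"
  proof -
    have "(\<lambda>k. 1 / (real k * \<delta>\<^sup>2)) \<longlonglongrightarrow> 0" using \<delta> by real_asymp
    from tendsto_add[OF E1_lim this] show ?thesis by simp
  qed
  \<comment> \<open>Outside \<open>E1\<close> the fading and the root of \<open>C1 k\<close> use up
    at most two of the three factors \<open>2 powr g\<close> in \<open>gap\<close>. The third pushes
    the noise energy into \<open>E2\<close>, the 4 of the packing bound cancelling the 4 in
    \<open>gap\<close>.\<close>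
  have error_event: "\<omega> \<in> E1 k \<union> E2 k"
    if k: "k \<in> K" and root: "(exp 1 * real k) powr (1 / real k) \<le> 2 powr g" and \<omega>: "\<omega> \<in> space M"
      and err: "real k * (2 powr S k \<omega> * (C1 k powr (1 / real k) * P / 2 powr R * Nd_p_min k (L k) powr (2 / real k)))
         \<le> 4 * (\<Sum>i<k. (cmod (w i \<omega>))\<^sup>2)" for k \<omega>
  proof (cases "\<omega> \<in> E1 k")
    case False
    then have S_ge: "S k \<omega> \<ge> l - g" using \<omega> by (auto simp: E1_def)
    have "2 powr (- g) * (pi * exp 1) \<le> pi * exp 1 / (exp 1 * real k) powr (1 / real k)"
      using root k1[OF k] by (simp add: powr_minus field_simps)
    also have "\<dots> \<le> C1 k powr (1 / real k)" by (rule C1_root_ge[OF k1[OF k]])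
    finally have C1_ge: "C1 k powr (1 / real k) \<ge> 2 powr (- g) * (pi * exp 1)" .
    have "4 * (real k * (1 + \<delta>)) = 4 * real k * (2 powr (3 * g) * 2 powr (- g) * 2 powr (- g))"
      by (simp add: \<delta>_def powr_add[symmetric])
    also have "\<dots> = real k * ((2 powr l * 2 powr (- g)) * ((2 powr (- g) * (pi * exp 1)) * P / 2 powr R * c))"
      unfolding gap by (simp add: field_simps)
    also have "\<dots> = real k * (2 powr (l - g) * ((2 powr (- g) * (pi * exp 1)) * P / 2 powr R * c))"
      by (simp add: powr_add[symmetric])
    also have "\<dots> \<le> real k * (2 powr S k \<omega> * (C1 k powr (1 / real k) * P / 2 powr R * Nd_p_min k (L k) powr (2 / real k)))"
      using S_ge C1_ge assms(15)[OF k] P c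
      by (intro mult_left_mono mult_mono divide_right_mono powr_mono mult_right_mono) auto
    finally show ?thesis using err \<omega> by (simp add: E2_def)
  qed simp
  \<comment> \<open>The search set \<open>T\<close> is instantiated with the code for maximum
    likelihood and with the whole shifted lattice for naive decoding.\<close>
  have error_lim: "((\<lambda>k. error_prob M h w k (code k (L k) P R (xR k)) (D k)) \<longlongrightarrow> 0)
          (inf sequentially (principal K))"
    if adm: "\<And>k. k \<in> K \<Longrightarrow> admissible_shift k (L k) P R (xR k)"
      and dec: "\<And>k. k \<in> K \<Longrightarrow> min_dist_decoder k (T k) (D k)"
      and T: "\<And>k. k \<in> K \<Longrightarrow> code k (L k) P R (xR k) \<subseteq> T k"
             "\<And>k. k \<in> K \<Longrightarrow> T k \<subseteq> shifted_lattice k (L k) P R (xR k)"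
    for xR D T
  proof (rule tendsto_sandwich)
    show "\<forall>\<^sub>F k in inf sequentially (principal K). 0 \<le> error_prob M h w k (code k (L k) P R (xR k)) (D k)"
      by (simp add: error_prob_def)
    have "error_prob M h w k (code k (L k) P R (xR k)) (D k) \<le> measure M (E1 k) + 1 / (real k * \<delta>\<^sup>2)"
      if k: "k \<in> K" and root: "(exp 1 * real k) powr (1 / real k) \<le> 2 powr g" for k
    proof -
      have "real (card (code k (L k) P R (xR k))) > 0"
        using adm[OF k] unfolding admissible_shift_def by (smt (verit) powr_gt_zero)
      then have ne: "code k (L k) P R (xR k) \<noteq> {}" by auto
      have "error_prob M h w k (code k (L k) P R (xR k)) (D k) \<le> measure M (E1 k \<union> E2 k)"
      proof (rule error_prob_le[OF assms(1,2,3) L[OF k] vol[OF k] Nd[OF k] P k1[OF k] _ ne T(1)[OF k] T(2)[OF k] dec[OF k]])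
        show "finite (code k (L k) P R (xR k))"
          by (rule finite_code[OF L[OF k] vol[OF k] Nd[OF k] P k1[OF k]])
      qed (use error_event[OF k root] in \<open>auto simp: S_def\<close>)
      also have "\<dots> \<le> measure M (E1 k) + measure M (E2 k)"
        by (intro measure_Un_le) auto
      also have "measure M (E2 k) \<le> 1 / (real k * \<delta>\<^sup>2)"
        unfolding E2_def by (rule M.cgaussian_energy_tail[OF assms(8,9) k1[OF k] \<delta>])
      finally show ?thesis by simp
    qed
    then show "\<forall>\<^sub>F k in inf sequentially (principal K). error_prob M h w k (code k (L k) P R (xR k)) (D k) \<le>
        measure M (E1 k) + 1 / (real k * \<delta>\<^sup>2)"
      \<comment> \<open>Along this filter membership in \<open>K\<close> may be assumed, and the
        bound on the root holds for all large \<open>k\<close>.\<close>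
      unfolding eventually_inf_principal by (intro eventually_mono[OF eventually_root_le[OF g]]) blast
    show "((\<lambda>k. measure M (E1 k) + 1 / (real k * \<delta>\<^sup>2)) \<longlongrightarrow> 0) (inf sequentially (principal K))"
      by (rule tendsto_mono[OF inf_le1 E_lim])
  qed simp
  \<comment> \<open>A nonempty countable search set has a decoder. The code is nonempty because its
    size is at least a power of 2, hence positive.\<close>
  have codes_exist: "\<exists>xR. admissible_shift k (L k) P R xR \<and> (\<exists>D. max_likelihood_decoder k (L k) P R xR D)
      \<and> (\<exists>D. naive_lattice_decoder k (L k) P R xR D)" if k: "k \<in> K" for k
  proof -
    obtain xR where xR: "admissible_shift k (L k) P R xR"
      using exists_admissible_shift[OF L[OF k] vol[OF k] Nd[OF k] P k1[OF k]] by blast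
    have "real (card (code k (L k) P R xR)) > 0"
      using xR unfolding admissible_shift_def by (smt (verit) powr_gt_zero)
    then have ne: "code k (L k) P R xR \<noteq> {}" by auto
    have sub: "code k (L k) P R xR \<subseteq> shifted_lattice k (L k) P R xR" by (auto simp: code_def)
    have cnt: "countable (shifted_lattice k (L k) P R xR)"
      by (rule countable_shifted_lattice[OF L[OF k]])
    show ?thesis
      unfolding max_likelihood_decoder_def naive_lattice_decoder_def
      using xR ne sub cnt exists_min_dist_decoder countable_subset[OF sub cnt]
      by (metis subset_empty)
  qed
  show ?thesis
  proof
    show "achievable M h w K L P max_likelihood_decoder R"
      unfolding achievable_def
    proof (intro conjI allI impI)
      fix xR D assume "\<forall>k\<in>K. admissible_shift k (L k) P R (xR k) \<and> max_likelihood_decoder k (L k) P R (xR k) (D k)"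
      then show "((\<lambda>k. error_prob M h w k (code k (L k) P R (xR k)) (D k)) \<longlongrightarrow> 0) (inf sequentially (principal K))"
        by (intro error_lim[of xR "\<lambda>k. code k (L k) P R (xR k)" D])
           (auto simp: max_likelihood_decoder_def code_def)
    qed (use codes_exist in blast)
    show "achievable M h w K L P naive_lattice_decoder R"
      unfolding achievable_def
    proof (intro conjI allI impI)
      fix xR D assume "\<forall>k\<in>K. admissible_shift k (L k) P R (xR k) \<and> naive_lattice_decoder k (L k) P R (xR k) (D k)"
      then show "((\<lambda>k. error_prob M h w k (code k (L k) P R (xR k)) (D k)) \<longlongrightarrow> 0) (inf sequentially (principal K))"
        by (intro error_lim[of xR "\<lambda>k. shifted_lattice k (L k) P R (xR k)" D])
           (auto simp: naive_lattice_decoder_def code_def)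
    qed (use codes_exist in blast)
  qed
qed

end
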